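(* Let $\mathcal{M}=G/H$ be a reductive homogeneous space with reductive complement $\mathfrak{m}$, let $c_0\in\mathcal{M}$, $g_0\in\pi^{-1}(c_0)$, and let $\mathcal{R}_{\mathfrak{m}}\colon\mathcal{P}_{c_0}\to C^\infty(I,\mathfrak{m}\setminus\{0\})$ be the reductive square root velocity transform. Then the distance $d_{\mathcal{P}_{c_0},\mathfrak{m}}(f,g):=d_{L^2}(\mathcal{R}_{\mathfrak{m}}(f),\mathcal{R}_{\mathfrak{m}}(g))$ on $\mathcal{P}_{c_0}$ is reparametrisation invariant.
   Context: $G$ is a finite-dimensional Lie group with identity $e$ and Lie algebra $\mathfrak{g}=T_eG$; $H\subseteq G$ is a closed Lie subgroup with Lie algebra $\mathfrak{h}$; $\mathcal{M}=G/H$ carries the manifold structure making $\pi\colon G\to G/H$, $g\mapsto gH$, a submersion. $\Lambda\colon G\times\mathcal{M}\to\mathcal{M}$, $(g,kH)\mapsto(gk)H$, with $\Lambda^g=\Lambda(g,\cdot)$. $I=[0,1]$. $\mathcal{P}_{c_0}$ is the set of smooth curves $c\colon I\to\mathcal{M}$ with $c(0)=c_0$ and nowhere vanishing derivative. $\mathcal{M}$ is reductive: $\mathfrak{m}\subseteq\mathfrak{g}$ is a fixed vector subspace with $\mathfrak{g}=\mathfrak{h}\oplus\mathfrak{m}$ and $\mathrm{Ad}(h).\mathfrak{m}\subseteq\mathfrak{m}$ for all $h\in H$ (a reductive complement). Let $\omega_e\colon T_{eH}\mathcal{M}\to\mathfrak{m}$ be the inverse of the isomorphism $T_e\pi|_{\mathfrak{m}}$.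 Define the (well-defined) $1$-form $\omega\colon T\mathcal{M}\to\mathfrak{g}$ by $\omega(v)=\mathrm{Ad}(g).\omega_e(T\Lambda^{g^{-1}}(v))$ for $v\in T_{gH}\mathcal{M}$, and $\theta_\omega(f)=\omega\circ f$ for $f\in C^\infty(I,T\mathcal{M})$. $\mathrm{Evol}\colon C^\infty(I,\mathfrak{g})\to\{g\in C^\infty(I,G): g(0)=e\}$ sends $q$ to the solution $g$ of $\dot g(t)=T_eR_{g(t)}(q(t))$, $g(0)=e$, where $R_g$ is right multiplication by $g$. For $k\in G$, $\Psi_k(q)=-\mathrm{Ad}(k\,\mathrm{Evol}(q)^{-1}).q$ (pointwise in $t$) for $q\in C^\infty(I,\mathfrak{g})$. $\|\cdot\|$ is the norm of a fixed inner product on $\mathfrak{g}$ (from a right invariant Riemannian metric on $G$), and $d_{L^2}(p,q)=\big(\int_0^1\|p(t)-q(t)\|^2dt\big)^{1/2}$. The reductive square root velocity transform is $\mathcal{R}_{\mathfrak{m}}(f)=\Psi_{g_0^{-1}}(\theta_\omega(\dot f))/\sqrt{\|\Psi_{g_0^{-1}}(\theta_\omega(\dot f))\|}$. $\mathrm{Diff}^+(I)$ is the group of orientation preserving diffeomorphisms of $I$. A distance $d$ on $\mathcal{P}_{c_0}$ is reparametrisation invariant if $d(f,g)=d(f\circ\varphi,g\circ\varphi)$ for all $f,g\in\mathcal{P}_{c_0}$ and $\varphi\in\mathrm{Diff}^+(I)$. *)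

theory Defs
  imports "HOL-Analysis.Analysis" "HOL-Algebra.Left_Coset"
begin

section \<open>Smooth maps between Euclidean spaces\<close>

text \<open>Derivatives are taken within \<open>S\<close>. The definition is meant for open \<open>S\<close> and for relatively
  open subsets \<open>S\<close> of \<open>{0..1}\<close> (one-sided derivatives at the end points), where these
  derivatives are unique.\<close>

primrec Ck_on :: "nat \<Rightarrow> 'a::real_normed_vector set \<Rightarrow> ('a \<Rightarrow> 'b::real_normed_vector) \<Rightarrow> bool" where
  "Ck_on 0 S f \<longleftrightarrow> continuous_on S f"
| "Ck_on (Suc k) S f \<longleftrightarrow> f differentiable_on S \<and>
     (\<forall>v. Ck_on k S (\<lambda>x. frechet_derivative f (at x within S) v))"

definition smooth_on :: "'a::real_normed_vector set \<Rightarrow> ('a \<Rightarrow> 'b::real_normed_vector) \<Rightarrow> bool" where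
  "smooth_on S f \<longleftrightarrow> (\<forall>k. Ck_on k S f)"

section \<open>Smooth manifolds\<close>

type_synonym ('a, 'e) chart = "'a set \<times> ('a \<Rightarrow> 'e)"

record ('a, 'e) manifold =
  mfd_topology :: "'a topology"
  mfd_atlas :: "('a, 'e) chart set"

abbreviation points :: "('a, 'e) manifold \<Rightarrow> 'a set" where
  "points M \<equiv> topspace (mfd_topology M)"

definition topological_chart :: "'a topology \<Rightarrow> ('a, 'e::euclidean_space) chart \<Rightarrow> bool" where
  "topological_chart X = (\<lambda>(U, \<xi>). openin X U \<and> open (\<xi> ` U) \<and>
     homeomorphic_map (subtopology X U) (top_of_set (\<xi> ` U)) \<xi>)"

definition smooth_transition ::
  "('a, 'e::euclidean_space) chart \<Rightarrow> ('a, 'e) chart \<Rightarrow> bool" where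
  "smooth_transition = (\<lambda>(U, \<xi>) (V, \<psi>). smooth_on (\<xi> ` (U \<inter> V)) (\<psi> \<circ> inv_into U \<xi>))"

definition smooth_manifold :: "('a, 'e::euclidean_space) manifold \<Rightarrow> bool" where
  "smooth_manifold M \<longleftrightarrow>
     Hausdorff_space (mfd_topology M) \<and> second_countable (mfd_topology M) \<and>
     (\<forall>c\<in>mfd_atlas M. topological_chart (mfd_topology M) c) \<and>
     \<Union> (fst ` mfd_atlas M) = points M \<and>
     (\<forall>c\<in>mfd_atlas M. \<forall>d\<in>mfd_atlas M. smooth_transition c d)"

definition compatible_chart ::
  "('a, 'e::euclidean_space) manifold \<Rightarrow> ('a, 'e) chart \<Rightarrow> bool" where
  "compatible_chart M c \<longleftrightarrow> topological_chart (mfd_topology M) c \<and>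
     (\<forall>d\<in>mfd_atlas M. smooth_transition c d \<and> smooth_transition d c)"

definition smooth_map ::
  "('a, 'e::euclidean_space) manifold \<Rightarrow> ('b, 'f::euclidean_space) manifold \<Rightarrow> ('a \<Rightarrow> 'b) \<Rightarrow> bool" where
  "smooth_map M N f \<longleftrightarrow> continuous_map (mfd_topology M) (mfd_topology N) f \<and>
     (\<forall>(U, \<xi>)\<in>mfd_atlas M. \<forall>(V, \<psi>)\<in>mfd_atlas N.
        smooth_on (\<xi> ` (U \<inter> f -` V)) (\<psi> \<circ> f \<circ> inv_into U \<xi>))"

definition prod_manifold ::
  "('a, 'e) manifold \<Rightarrow> ('b, 'f) manifold \<Rightarrow> ('a \<times> 'b, 'e \<times> 'f) manifold" where
  "prod_manifold M N =
     \<lparr>mfd_topology = prod_topology (mfd_topology M) (mfd_topology N),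
      mfd_atlas = (\<lambda>((U, \<xi>), (V, \<psi>)). (U \<times> V, map_prod \<xi> \<psi>)) ` (mfd_atlas M \<times> mfd_atlas N)\<rparr>"

text \<open>Fixing one chart around each point \<open>p\<close> identifies the tangent space at \<open>p\<close> with the model space:
  a tangent vector at \<open>p\<close> is represented by its coordinates in the chart \<open>chart_at M p\<close>. In
  particular, the Lie algebra of a Lie group modelled on \<open>'e\<close> is, as a vector space, \<open>'e\<close>.\<close>

definition chart_at :: "('a, 'e) manifold \<Rightarrow> 'a \<Rightarrow> ('a, 'e) chart" where
  "chart_at M p = (SOME c. c \<in> mfd_atlas M \<and> p \<in> fst c)"

definition tangent_map ::
  "('a, 'e::euclidean_space) manifold \<Rightarrow> ('b, 'f::euclidean_space) manifold \<Rightarrow> ('a \<Rightarrow> 'b)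
     \<Rightarrow> 'a \<Rightarrow> 'e \<Rightarrow> 'f" where
  "tangent_map M N f p =
     (let (U, \<xi>) = chart_at M p; (V, \<psi>) = chart_at N (f p)
      in frechet_derivative (\<psi> \<circ> f \<circ> inv_into U \<xi>) (at (\<xi> p)))"

definition submersion ::
  "('a, 'e::euclidean_space) manifold \<Rightarrow> ('b, 'f::euclidean_space) manifold \<Rightarrow> ('a \<Rightarrow> 'b) \<Rightarrow> bool" where
  "submersion M N f \<longleftrightarrow> smooth_map M N f \<and> (\<forall>p\<in>points M. surj (tangent_map M N f p))"

section \<open>Smooth curves on the unit interval\<close>

text \<open>A curve is a function on \<open>real\<close> of which only the values on \<open>{0..1}\<close> matter.\<close>

definition smooth_curve :: "('a, 'e::euclidean_space) manifold \<Rightarrow> (real \<Rightarrow> 'a) \<Rightarrow> bool" where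
  "smooth_curve M c \<longleftrightarrow> continuous_map (top_of_set {0..1}) (mfd_topology M) c \<and>
     (\<forall>(U, \<xi>)\<in>mfd_atlas M. smooth_on ({0..1} \<inter> c -` U) (\<xi> \<circ> c))"

text \<open>The derivative of \<open>c\<close> at \<open>t\<close>, a tangent vector at \<open>c t\<close>.\<close>

definition velocity :: "('a, 'e::euclidean_space) manifold \<Rightarrow> (real \<Rightarrow> 'a) \<Rightarrow> real \<Rightarrow> 'e" where
  "velocity M c t = vector_derivative (snd (chart_at M (c t)) \<circ> c) (at t within {0..1})"

definition regular_curves :: "('a, 'e::euclidean_space) manifold \<Rightarrow> 'a \<Rightarrow> (real \<Rightarrow> 'a) set" where
  "regular_curves M p = {c. smooth_curve M c \<and> c 0 = p \<and> (\<forall>t\<in>{0..1}. velocity M c t \<noteq> 0)}"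

definition Diff_plus :: "(real \<Rightarrow> real) set" where
  "Diff_plus = {\<phi>. bij_betw \<phi> {0..1} {0..1} \<and> smooth_on {0..1} \<phi> \<and>
     smooth_on {0..1} (inv_into {0..1} \<phi>) \<and>
     (\<forall>t\<in>{0..1}. vector_derivative \<phi> (at t within {0..1}) > 0)}"

definition reparametrisation_invariant ::
  "(real \<Rightarrow> 'a) set \<Rightarrow> ((real \<Rightarrow> 'a) \<Rightarrow> (real \<Rightarrow> 'a) \<Rightarrow> real) \<Rightarrow> bool" where
  "reparametrisation_invariant P d \<longleftrightarrow>
     (\<forall>f\<in>P. \<forall>g\<in>P. \<forall>\<phi>\<in>Diff_plus. d f g = d (f \<circ> \<phi>) (g \<circ> \<phi>))"

section \<open>Lie groups\<close>

definition lie_group :: "'g monoid \<Rightarrow> ('g, 'e::euclidean_space) manifold \<Rightarrow> bool" where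
  "lie_group G MG \<longleftrightarrow> group G \<and> smooth_manifold MG \<and> points MG = carrier G \<and>
     smooth_map (prod_manifold MG MG) MG (\<lambda>(x, y). x \<otimes>\<^bsub>G\<^esub> y) \<and>
     smooth_map MG MG (\<lambda>x. inv\<^bsub>G\<^esub> x)"

definition Ad :: "'g monoid \<Rightarrow> ('g, 'e::euclidean_space) manifold \<Rightarrow> 'g \<Rightarrow> 'e \<Rightarrow> 'e" where
  "Ad G MG g = tangent_map MG MG (\<lambda>x. g \<otimes>\<^bsub>G\<^esub> x \<otimes>\<^bsub>G\<^esub> inv\<^bsub>G\<^esub> g) \<one>\<^bsub>G\<^esub>"

definition is_evolution ::
  "'g monoid \<Rightarrow> ('g, 'e::euclidean_space) manifold \<Rightarrow> (real \<Rightarrow> 'e) \<Rightarrow> (real \<Rightarrow> 'g) \<Rightarrow> bool" where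
  "is_evolution G MG q g \<longleftrightarrow> smooth_curve MG g \<and> g 0 = \<one>\<^bsub>G\<^esub> \<and>
     (\<forall>t\<in>{0..1}. velocity MG g t = tangent_map MG MG (\<lambda>x. x \<otimes>\<^bsub>G\<^esub> g t) \<one>\<^bsub>G\<^esub> (q t))"

text \<open>For smooth \<open>q\<close> the initial value problem has a solution, and its values on \<open>{0..1}\<close> are unique;
  the \<open>else\<close> branch only makes the function total.\<close>

definition Evol ::
  "'g monoid \<Rightarrow> ('g, 'e::euclidean_space) manifold \<Rightarrow> (real \<Rightarrow> 'e) \<Rightarrow> real \<Rightarrow> 'g" where
  "Evol G MG q = (if \<exists>g. is_evolution G MG q g then SOME g. is_evolution G MG q g
                  else (\<lambda>t. \<one>\<^bsub>G\<^esub>))"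

definition Psi ::
  "'g monoid \<Rightarrow> ('g, 'e::euclidean_space) manifold \<Rightarrow> 'g \<Rightarrow> (real \<Rightarrow> 'e) \<Rightarrow> real \<Rightarrow> 'e" where
  "Psi G MG k q t = - Ad G MG (k \<otimes>\<^bsub>G\<^esub> inv\<^bsub>G\<^esub> (Evol G MG q t)) (q t)"

text \<open>Closed Lie subgroups are closed subgroups that are (embedded) submanifolds: around each of
  its points there is a chart in which the subgroup is a fixed linear subspace \<open>L\<close> of the model
  space.\<close>

definition closed_lie_subgroup ::
  "'g monoid \<Rightarrow> ('g, 'e::euclidean_space) manifold \<Rightarrow> 'g set \<Rightarrow> bool" where
  "closed_lie_subgroup G MG H \<longleftrightarrow> subgroup H G \<and> closedin (mfd_topology MG) H \<and>
     (\<exists>L. subspace L \<and> (\<forall>h\<in>H. \<exists>U \<xi>. compatible_chart MG (U, \<xi>) \<and> h \<in> U \<and>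
        \<xi> ` (U \<inter> H) = \<xi> ` U \<inter> L))"

text \<open>The tangent space of \<open>H\<close> at the identity, as a subspace of the Lie algebra of \<open>G\<close>.\<close>

definition lie_algebra_of ::
  "'g monoid \<Rightarrow> ('g, 'e::euclidean_space) manifold \<Rightarrow> 'g set \<Rightarrow> 'e set" where
  "lie_algebra_of G MG H =
     {velocity MG c 0 |c. smooth_curve MG c \<and> c ` {0..1} \<subseteq> H \<and> c 0 = \<one>\<^bsub>G\<^esub>}"

section \<open>Reductive homogeneous spaces\<close>

text \<open>The projection of \<open>G\<close> onto \<open>G/H\<close>, the set of left cosets of \<open>H\<close>.\<close>

definition coset_proj :: "'g monoid \<Rightarrow> 'g set \<Rightarrow> 'g \<Rightarrow> 'g set" where
  "coset_proj G H g = g <#\<^bsub>G\<^esub> H"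

text \<open>The action of \<open>G\<close> on \<open>G/H\<close>; translating the set \<open>k <# H\<close> by \<open>g\<close> gives
  \<open>(g \<otimes> k) <# H\<close>.\<close>

definition coset_action :: "'g monoid \<Rightarrow> 'g \<Rightarrow> 'g set \<Rightarrow> 'g set" where
  "coset_action G g p = g <#\<^bsub>G\<^esub> p"

text \<open>The manifold structure \<open>M\<close> on \<open>G/H\<close> is determined by the projection being a submersion.\<close>

definition homogeneous_space ::
  "'g monoid \<Rightarrow> ('g, 'e::euclidean_space) manifold \<Rightarrow> 'g set
     \<Rightarrow> ('g set, 'f::euclidean_space) manifold \<Rightarrow> bool" where
  "homogeneous_space G MG H M \<longleftrightarrow> lie_group G MG \<and> closed_lie_subgroup G MG H \<and>
     smooth_manifold M \<and> points M = lcosets\<^bsub>G\<^esub> H \<and> submersion MG M (coset_proj G H)"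

definition reductive_complement ::
  "'g monoid \<Rightarrow> ('g, 'e::euclidean_space) manifold \<Rightarrow> 'g set \<Rightarrow> 'e set \<Rightarrow> bool" where
  "reductive_complement G MG H \<mm> \<longleftrightarrow> subspace \<mm> \<and>
     lie_algebra_of G MG H \<inter> \<mm> = {0} \<and>
     (\<forall>X. \<exists>Y\<in>lie_algebra_of G MG H. \<exists>Z\<in>\<mm>. X = Y + Z) \<and>
     (\<forall>h\<in>H. Ad G MG h ` \<mm> \<subseteq> \<mm>)"

definition omega_e ::
  "'g monoid \<Rightarrow> ('g, 'e::euclidean_space) manifold \<Rightarrow> 'g set
     \<Rightarrow> ('g set, 'f::euclidean_space) manifold \<Rightarrow> 'e set \<Rightarrow> 'f \<Rightarrow> 'e" where
  "omega_e G MG H M \<mm> = inv_into \<mm> (tangent_map MG M (coset_proj G H) \<one>\<^bsub>G\<^esub>)"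

text \<open>The value on a tangent vector \<open>v\<close> at \<open>p\<close>. On a reductive homogeneous space it does not depend
  on the choice of the representative \<open>g\<close> of \<open>p\<close>.\<close>

definition omega ::
  "'g monoid \<Rightarrow> ('g, 'e::euclidean_space) manifold \<Rightarrow> 'g set
     \<Rightarrow> ('g set, 'f::euclidean_space) manifold \<Rightarrow> 'e set \<Rightarrow> 'g set \<Rightarrow> 'f \<Rightarrow> 'e" where
  "omega G MG H M \<mm> p v =
     (let g = (SOME g. g \<in> carrier G \<and> coset_proj G H g = p)
      in Ad G MG g (omega_e G MG H M \<mm> (tangent_map M M (coset_action G (inv\<^bsub>G\<^esub> g)) p v)))"

text \<open>The composite of \<open>\<omega>\<close> with the derivative of the curve \<open>f\<close>, viewed as a curve in the tangent
  bundle.\<close>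

definition theta_omega ::
  "'g monoid \<Rightarrow> ('g, 'e::euclidean_space) manifold \<Rightarrow> 'g set
     \<Rightarrow> ('g set, 'f::euclidean_space) manifold \<Rightarrow> 'e set \<Rightarrow> (real \<Rightarrow> 'g set) \<Rightarrow> real \<Rightarrow> 'e" where
  "theta_omega G MG H M \<mm> f t = omega G MG H M \<mm> (f t) (velocity M f t)"

section \<open>The square root velocity transform\<close>

definition inner_product :: "('e::real_vector \<Rightarrow> 'e \<Rightarrow> real) \<Rightarrow> bool" where
  "inner_product B \<longleftrightarrow> (\<forall>x. linear (B x)) \<and> (\<forall>x y. B x y = B y x) \<and> (\<forall>x. x \<noteq> 0 \<longrightarrow> B x x > 0)"

definition norm_of :: "('e \<Rightarrow> 'e \<Rightarrow> real) \<Rightarrow> 'e \<Rightarrow> real" where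
  "norm_of B x = sqrt (B x x)"

definition dist_L2 ::
  "('e::real_vector \<Rightarrow> 'e \<Rightarrow> real) \<Rightarrow> (real \<Rightarrow> 'e) \<Rightarrow> (real \<Rightarrow> 'e) \<Rightarrow> real" where
  "dist_L2 B p q = sqrt (integral {0..1} (\<lambda>t. (norm_of B (p t - q t))\<^sup>2))"

definition reductive_srvt ::
  "'g monoid \<Rightarrow> ('g, 'e::euclidean_space) manifold \<Rightarrow> 'g set
     \<Rightarrow> ('g set, 'f::euclidean_space) manifold \<Rightarrow> 'e set \<Rightarrow> ('e \<Rightarrow> 'e \<Rightarrow> real) \<Rightarrow> 'g
     \<Rightarrow> (real \<Rightarrow> 'g set) \<Rightarrow> real \<Rightarrow> 'e" where
  "reductive_srvt G MG H M \<mm> B g0 f t =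
     (let w = Psi G MG (inv\<^bsub>G\<^esub> g0) (theta_omega G MG H M \<mm> f) t
      in (1 / sqrt (norm_of B w)) *\<^sub>R w)"

definition reductive_srvt_dist ::
  "'g monoid \<Rightarrow> ('g, 'e::euclidean_space) manifold \<Rightarrow> 'g set
     \<Rightarrow> ('g set, 'f::euclidean_space) manifold \<Rightarrow> 'e set \<Rightarrow> ('e \<Rightarrow> 'e \<Rightarrow> real) \<Rightarrow> 'g
     \<Rightarrow> (real \<Rightarrow> 'g set) \<Rightarrow> (real \<Rightarrow> 'g set) \<Rightarrow> real" where
  "reductive_srvt_dist G MG H M \<mm> B g0 f g =
     dist_L2 B (reductive_srvt G MG H M \<mm> B g0 f) (reductive_srvt G MG H M \<mm> B g0 g)"

end

theory Submission
  imports Defs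
begin

text \<open>Reparametrising a curve \<open>f\<close> by \<open>\<phi>\<close> multiplies its velocity by \<open>\<phi>'\<close>. The form \<open>\<omega>\<close> is linear on each
  tangent space, so \<open>q = \<theta>\<^sub>\<omega>(f)\<close> turns into \<open>r = \<phi>' (q \<circ> \<phi>)\<close>. If \<open>g\<close> solves the evolution equation for \<open>q\<close>, then
  \<open>g \<circ> \<phi>\<close> solves it for \<open>r\<close>, so uniqueness of solutions gives \<open>Evol(r) = Evol(q) \<circ> \<phi>\<close>. As \<open>Ad\<close> acts linearly, \<open>\<Psi>\<close>
  also gains the factor \<open>\<phi>'\<close> (\<open>Psi_reparametrise\<close>), and dividing by the square root of the norm leaves
  \<open>R(f \<circ> \<phi>) = sqrt(\<phi>') (R(f) \<circ> \<phi>)\<close>. The factor \<open>\<phi>'\<close> in the squared distance of two such curves is the one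
  in the substitution rule (\<open>integral_Diff_plus_substitution\<close>).

  Two points carry the geometric content. The first is uniqueness of the evolution
  (\<open>evolution_unique\<close>): for two solutions \<open>g1\<close> and \<open>g2\<close>, the curve \<open>inv g1 \<otimes> g2\<close> has velocity zero at every
  time, because the map \<open>(x, y) \<mapsto> inv x \<otimes> y\<close> is invariant under simultaneous left translation, and the
  equation says that both velocities come from the same infinitesimal left translation.

  The second is the homogeneity of \<open>\<omega>\<close> (\<open>omega_scaleR\<close>). It requires that the action of a group element on the
  quotient be differentiable, and that the tangent map of the projection at the identity restrict to a
  bijection from \<open>\<mm>\<close>, so that \<open>\<omega>\<^sub>e\<close>, being defined by a choice of preimages, is homogeneous. Both follow from
  the normal form of a submersion (\<open>submersion_local_inverse\<close>), obtained from the inverse function theorem: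
  it gives local sections of the projection, through which the action lifts to left multiplication, and it
  shows that a vector in the kernel of the tangent map is tangent to the fibre \<open>H\<close>, hence, up to scaling,
  the velocity of a smooth curve in \<open>H\<close> (\<open>kernel_proj_lie_algebra\<close>).\<close>

section \<open>Calculus of iterated derivatives on the unit interval\<close>

lemma at_within_openin:
  assumes "openin (top_of_set S) T" "x \<in> T"
  shows "at x within T = at x within S"
proof -
  obtain U where "open U" "T = S \<inter> U" using assms(1) by (auto simp: openin_open)
  then show ?thesis using assms(2) by (intro at_within_nhd[of _ U]) auto
qed

text \<open>Both sides choose among the same linear maps, so the equation holds even where \<open>f\<close> is not
  differentiable or the derivative is not unique.\<close>

lemma frechet_derivative_cong_within:
  assumes "\<And>y. y \<in> S \<Longrightarrow> f y = g y" "x \<in> S"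
  shows "frechet_derivative f (at x within S) = frechet_derivative g (at x within S)"
proof -
  have "(f has_derivative D) (at x within S) \<longleftrightarrow> (g has_derivative D) (at x within S)" for D
    using assms by (metis has_derivative_transform)
  then show ?thesis by (simp add: frechet_derivative_def)
qed

lemma Ck_on_cong:
  assumes "\<And>x. x \<in> S \<Longrightarrow> f x = g x"
  shows "Ck_on k S f \<longleftrightarrow> Ck_on k S g"
  using assms
proof (induction k arbitrary: f g)
  case 0
  then show ?case by (simp cong: continuous_on_cong)
next
  case (Suc k)
  have "f differentiable_on S \<longleftrightarrow> g differentiable_on S"
    using Suc.prems unfolding differentiable_on_def differentiable_def
    by (metis has_derivative_transform)
  moreover have "Ck_on k S (\<lambda>x. frechet_derivative f (at x within S) v) \<longleftrightarrow>
      Ck_on k S (\<lambda>x. frechet_derivative g (at x within S) v)" for v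
    by (rule Suc.IH) (simp add: frechet_derivative_cong_within[OF Suc.prems])
  ultimately show ?case by simp
qed

lemma Ck_on_openin_subset:
  assumes "Ck_on k S f" "openin (top_of_set S) T"
  shows "Ck_on k T f"
  using assms(1)
proof (induction k arbitrary: f)
  case 0
  then show ?case using assms(2) by (auto intro: continuous_on_subset dest: openin_imp_subset)
next
  case (Suc k)
  have T: "T \<subseteq> S" using assms(2) by (rule openin_imp_subset)
  have "f differentiable_on T" using Suc.prems T by (auto intro: differentiable_on_subset)
  moreover have "Ck_on k T (\<lambda>x. frechet_derivative f (at x within T) v)" for v
  proof -
    have "Ck_on k T (\<lambda>x. frechet_derivative f (at x within S) v)"
      using Suc by simp
    then show ?thesis
      by (rule Ck_on_cong[THEN iffD1, rotated]) (simp add: at_within_openin[OF assms(2)])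
  qed
  ultimately show ?case by simp
qed

lemma Ck_on_SucD: "Ck_on (Suc k) S f \<Longrightarrow> Ck_on k S f"
  by (induction k arbitrary: f) (auto simp: differentiable_imp_continuous_on)

text \<open>Relatively open subsets of the unit interval have no isolated points, so there the chosen
  derivative is the only one. This is what allows the usual differentiation rules to be applied to
  the iterated derivatives in \<^const>\<open>Ck_on\<close>.\<close>

lemma has_derivative_within_unit_interval_unique:
  fixes f :: "real \<Rightarrow> 'b::real_normed_vector"
  assumes "openin (top_of_set {0..1}) T" "t \<in> T"
    and F: "(f has_derivative F) (at t within T)" 
  shows "frechet_derivative f (at t within T) = F"
proof -
  have t: "t \<in> {0..1}" using openin_imp_subset[OF assms(1)] assms(2) by blast
  have nb: "at t within {0..1} \<noteq> bot"
    using t by (simp add: trivial_limit_within)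
  define F' where "F' = frechet_derivative f (at t within T)"
  have F': "(f has_derivative F') (at t within T)"
    unfolding F'_def using F differentiable_def frechet_derivative_works by blast
  have lin: "F s = s *\<^sub>R F 1" "F' s = s *\<^sub>R F' 1" for s
    using F F' by (metis has_derivative_linear linear_cmul mult.right_neutral real_scaleR_def)+
  have "(f has_vector_derivative F 1) (at t within {0..1})"
       "(f has_vector_derivative F' 1) (at t within {0..1})"
    unfolding has_vector_derivative_def at_within_openin[OF assms(1,2), symmetric]
      lin[symmetric] using F F' by simp_all
  then have "F 1 = F' 1" using vector_derivative_unique_within[OF nb] by blast
  then show ?thesis using lin unfolding F'_def by (metis ext)
qed

lemma Ck_on_SucI:
  fixes f :: "real \<Rightarrow> 'b::real_normed_vector"
  assumes "openin (top_of_set {0..1}) T"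
    and "\<And>t. t \<in> T \<Longrightarrow> (f has_derivative F t) (at t within T)"
    and "\<And>v. Ck_on k T (\<lambda>t. F t v)"
  shows "Ck_on (Suc k) T f"
proof -
  have "f differentiable_on T"
    using assms(2) by (auto simp: differentiable_on_def differentiable_def)
  moreover have "Ck_on k T (\<lambda>t. frechet_derivative f (at t within T) v)" for v
    by (rule Ck_on_cong[THEN iffD1, OF _ assms(3)[of v]])
       (simp add: has_derivative_within_unit_interval_unique[OF assms(1) _ assms(2)])
  ultimately show ?thesis by simp
qed

lemma Ck_on_has_derivative:
  assumes "Ck_on (Suc k) S f" "x \<in> S"
  shows "(f has_derivative frechet_derivative f (at x within S)) (at x within S)"
  using assms frechet_derivative_works by (auto simp: differentiable_on_def)

lemma Ck_on_add:
  fixes f g :: "real \<Rightarrow> 'b::real_normed_vector"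
  assumes T: "openin (top_of_set {0..1}) T" and "Ck_on k T f" "Ck_on k T g"
  shows "Ck_on k T (\<lambda>t. f t + g t)"
  using assms(2,3)
proof (induction k arbitrary: f g)
  case 0
  then show ?case by (auto intro: continuous_intros)
next
  case (Suc k)
  show ?case
  proof (rule Ck_on_SucI[OF T])
    fix t assume "t \<in> T"
    then show "((\<lambda>t. f t + g t) has_derivative
        (\<lambda>v. frechet_derivative f (at t within T) v + frechet_derivative g (at t within T) v))
        (at t within T)"
      using Suc.prems by (intro has_derivative_add Ck_on_has_derivative)
  qed (use Suc in auto)
qed

lemma Ck_on_scaleR:
  fixes f :: "real \<Rightarrow> real" and g :: "real \<Rightarrow> 'b::real_normed_vector"
  assumes T: "openin (top_of_set {0..1}) T" and "Ck_on k T f" "Ck_on k T g"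
  shows "Ck_on k T (\<lambda>t. f t *\<^sub>R g t)"
  using assms(2,3)
proof (induction k arbitrary: f g)
  case 0
  then show ?case by (auto intro: continuous_intros)
next
  case (Suc k)
  show ?case
  proof (rule Ck_on_SucI[OF T])
    fix t assume "t \<in> T"
    then show "((\<lambda>t. f t *\<^sub>R g t) has_derivative
        (\<lambda>v. f t *\<^sub>R frechet_derivative g (at t within T) v + frechet_derivative f (at t within T) v *\<^sub>R g t))
        (at t within T)"
      using Suc.prems by (intro has_derivative_scaleR Ck_on_has_derivative)
  next
    fix v
    show "Ck_on k T (\<lambda>t. f t *\<^sub>R frechet_derivative g (at t within T) v
        + frechet_derivative f (at t within T) v *\<^sub>R g t)"
      using Suc.prems Ck_on_SucD[OF Suc.prems(1)] Ck_on_SucD[OF Suc.prems(2)]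
      by (intro Ck_on_add[OF T] Suc.IH) auto
  qed
qed

text \<open>By the chain rule the derivative of \<open>g \<circ> \<phi>\<close> is a scalar multiple of \<open>g' \<circ> \<phi>\<close>; the induction
  therefore rests on the product rule for a scalar and a vector function.\<close>

lemma Ck_on_compose_real:
  fixes \<phi> :: "real \<Rightarrow> real" and g :: "real \<Rightarrow> 'b::real_normed_vector"
  assumes T: "openin (top_of_set {0..1}) T" and \<phi>: "Ck_on k T \<phi>" and g: "Ck_on k S g"
    and "\<phi> ` T \<subseteq> S"
  shows "Ck_on k T (g \<circ> \<phi>)"
  using \<phi> g
proof (induction k arbitrary: g)
  case 0
  then show ?case using assms(4) continuous_on_compose continuous_on_subset
    by (metis Ck_on.simps(1))
next
  case (Suc k)
  define d where "d t = frechet_derivative \<phi> (at t within T)" for t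
  define D where "D x = frechet_derivative g (at x within S)" for x
  show ?case
  proof (rule Ck_on_SucI[OF T])
    fix t assume t: "t \<in> T"
    then have pt: "\<phi> t \<in> S" using assms(4) by auto
    have "(\<phi> has_derivative d t) (at t within T)"
      unfolding d_def by (rule Ck_on_has_derivative[OF Suc.prems(1) t])
    moreover have D: "(g has_derivative D (\<phi> t)) (at (\<phi> t) within S)"
      unfolding D_def by (rule Ck_on_has_derivative[OF Suc.prems(2) pt])
    ultimately have "((g \<circ> \<phi>) has_derivative (D (\<phi> t) \<circ> d t)) (at t within T)"
      using assms(4) by (auto intro: diff_chain_within has_derivative_subset)
    moreover have "D (\<phi> t) \<circ> d t = (\<lambda>v. d t v *\<^sub>R (\<lambda>x. D x 1) (\<phi> t))"
    proof
      fix v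
      have "linear (D (\<phi> t))" using D by (rule has_derivative_linear)
      from linear_cmul[OF this, of "d t v" 1]
      show "(D (\<phi> t) \<circ> d t) v = d t v *\<^sub>R (\<lambda>x. D x 1) (\<phi> t)" by simp
    qed
    ultimately show "((g \<circ> \<phi>) has_derivative (\<lambda>v. d t v *\<^sub>R ((\<lambda>x. D x 1) \<circ> \<phi>) t)) (at t within T)"
      by simp
  next
    fix v
    show "Ck_on k T (\<lambda>t. d t v *\<^sub>R ((\<lambda>x. D x 1) \<circ> \<phi>) t)"
    proof (rule Ck_on_scaleR[OF T])
      show "Ck_on k T (\<lambda>t. d t v)" using Suc.prems(1) unfolding d_def by simp
      show "Ck_on k T ((\<lambda>x. D x 1) \<circ> \<phi>)"
        using Suc.prems(2) Ck_on_SucD[OF Suc.prems(1)] unfolding D_def by (intro Suc.IH) auto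
    qed
  qed
qed

text \<open>Along a straight line, each directional derivative of the composite is a directional derivative of
  \<open>g\<close> in a fixed direction, again composed with the line, so the induction hypothesis applies directly.\<close>

lemma Ck_on_compose_line:
  fixes g :: "'a::real_normed_vector \<Rightarrow> 'b::real_normed_vector"
  assumes T: "openin (top_of_set {0..1}) T" and g: "Ck_on k S g"
    and "(\<lambda>t. a + t *\<^sub>R X) ` T \<subseteq> S"
  shows "Ck_on k T (\<lambda>t. g (a + t *\<^sub>R X))"
  using g
proof (induction k arbitrary: g)
  case 0
  then have "continuous_on T (g \<circ> (\<lambda>t. a + t *\<^sub>R X))"
    using assms(3) by (intro continuous_on_compose continuous_intros) (auto intro: continuous_on_subset)
  then show ?case by (simp add: o_def)
next
  case (Suc k)
  define D where "D x = frechet_derivative g (at x within S)" for x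
  show ?case
  proof (rule Ck_on_SucI[OF T])
    fix t assume t: "t \<in> T"
    then have pt: "a + t *\<^sub>R X \<in> S" using assms(3) by auto
    have "((\<lambda>t. a + t *\<^sub>R X) has_derivative (\<lambda>v. v *\<^sub>R X)) (at t within T)"
      by (auto intro!: derivative_eq_intros)
    moreover have D: "(g has_derivative D (a + t *\<^sub>R X)) (at (a + t *\<^sub>R X) within S)"
      unfolding D_def by (rule Ck_on_has_derivative[OF Suc.prems pt])
    ultimately have "((g \<circ> (\<lambda>t. a + t *\<^sub>R X)) has_derivative (D (a + t *\<^sub>R X) \<circ> (\<lambda>v. v *\<^sub>R X))) (at t within T)"
      using assms(3) by (auto intro: diff_chain_within has_derivative_subset)
    then show "((\<lambda>t. g (a + t *\<^sub>R X)) has_derivative (\<lambda>v. D (a + t *\<^sub>R X) (v *\<^sub>R X))) (at t within T)"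
      by (simp add: o_def)
  next
    fix v
    show "Ck_on k T (\<lambda>t. D (a + t *\<^sub>R X) (v *\<^sub>R X))"
      using Suc.prems unfolding D_def by (intro Suc.IH) auto
  qed
qed

section \<open>Coordinate expressions and differentiable maps\<close>

definition chart_rep ::
  "('a, 'e) chart \<Rightarrow> ('b, 'f) chart \<Rightarrow> ('a \<Rightarrow> 'b) \<Rightarrow> 'e \<Rightarrow> 'f" where
  "chart_rep c d f = snd d \<circ> f \<circ> inv_into (fst c) (snd c)"

lemma topological_chartD:
  assumes "topological_chart X c"
  shows "openin X (fst c)" "inj_on (snd c) (fst c)"
    and "openin X W \<Longrightarrow> open (snd c ` (fst c \<inter> W))"
proof -
  obtain U \<xi> where c: "c = (U, \<xi>)" by force
  have U: "openin X U" and op: "open (\<xi> ` U)"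
    and hom: "homeomorphic_map (subtopology X U) (top_of_set (\<xi> ` U)) \<xi>"
    using assms by (auto simp: c topological_chart_def)
  have tU: "topspace (subtopology X U) = U"
    using openin_subset[OF U] by auto
  show "openin X (fst c)" "inj_on (snd c) (fst c)"
    using U hom tU by (auto simp: c homeomorphic_map_def)
  assume W: "openin X W"
  have "openin (subtopology X U) (U \<inter> W)"
    using W by (simp add: openin_subtopology_Int2)
  then have "openin (top_of_set (\<xi> ` U)) (\<xi> ` (U \<inter> W))"
    using homeomorphic_map_openness[OF hom, of "U \<inter> W"] tU by auto
  then show "open (snd c ` (fst c \<inter> W))"
    using op by (simp add: c openin_open_eq)
qed

text \<open>Inverse charts are only meaningful on the image of the chart. Coordinate expressions of composites
  split into composites of coordinate expressions on a neighbourhood of the kind provided here.\<close>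

lemma chart_inverse_neighbourhood:
  assumes c: "topological_chart X c" "p \<in> fst c"
    and f: "continuous_map X Y f" and W: "openin Y W" "f p \<in> W"
  obtains Q where "open Q" "snd c p \<in> Q"
    "\<And>u. u \<in> Q \<Longrightarrow> inv_into (fst c) (snd c) u \<in> fst c"
    "\<And>u. u \<in> Q \<Longrightarrow> snd c (inv_into (fst c) (snd c) u) = u"
    "\<And>u. u \<in> Q \<Longrightarrow> f (inv_into (fst c) (snd c) u) \<in> W"
proof
  note D = topological_chartD[OF c(1)]
  let ?W = "{x \<in> topspace X. f x \<in> W}"
  let ?Q = "snd c ` (fst c \<inter> ?W)"
  show "open ?Q" using f W(1) by (intro D(3) openin_continuous_map_preimage)
  show "snd c p \<in> ?Q" using c(2) W(2) openin_subset[OF D(1)] by blast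
  fix u assume "u \<in> ?Q"
  then obtain x where x: "x \<in> fst c" "f x \<in> W" "u = snd c x" by auto
  then have "inv_into (fst c) (snd c) u = x" using D(2) by simp
  then show "inv_into (fst c) (snd c) u \<in> fst c" "snd c (inv_into (fst c) (snd c) u) = u"
     "f (inv_into (fst c) (snd c) u) \<in> W" using x by auto
qed

lemma inv_into_chart [simp]:
  "topological_chart X c \<Longrightarrow> p \<in> fst c \<Longrightarrow> inv_into (fst c) (snd c) (snd c p) = p"
  by (simp add: topological_chartD(2))

lemma has_derivative_chart_rep_compose:
  assumes c: "topological_chart X c" "p \<in> fst c" and d: "topological_chart Y d" "f p \<in> fst d"
    and f: "continuous_map X Y f"
    and L: "(chart_rep c d f has_derivative L) (at (snd c p))"
    and K: "(chart_rep d e g has_derivative K) (at (snd d (f p)))"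
  shows "(chart_rep c e (g \<circ> f) has_derivative (K \<circ> L)) (at (snd c p))"
proof -
  obtain Q where Q: "open Q" "snd c p \<in> Q"
    "\<And>u. u \<in> Q \<Longrightarrow> f (inv_into (fst c) (snd c) u) \<in> fst d"
    using chart_inverse_neighbourhood[OF c f topological_chartD(1)[OF d(1)] d(2)] by metis
  have "chart_rep c d f (snd c p) = snd d (f p)"
    using c by (simp add: chart_rep_def)
  then have "((chart_rep d e g \<circ> chart_rep c d f) has_derivative (K \<circ> L)) (at (snd c p))"
    using L K by (metis diff_chain_at)
  then show ?thesis
    by (rule has_derivative_transform_within_open[OF _ Q(1,2)])
       (use Q(3) d(1) in \<open>simp add: chart_rep_def\<close>)
qed

lemma has_vector_derivative_chart_rep_compose:
  assumes d: "topological_chart Y d" "\<gamma> t \<in> fst d"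
    and \<gamma>: "continuous_map (top_of_set S) Y \<gamma>" and t: "t \<in> S"
    and v: "((snd d \<circ> \<gamma>) has_vector_derivative v) (at t within S)"
    and K: "(chart_rep d e g has_derivative K) (at (snd d (\<gamma> t)))"
  shows "((snd e \<circ> (g \<circ> \<gamma>)) has_vector_derivative K v) (at t within S)"
proof -
  have "((chart_rep d e g \<circ> (snd d \<circ> \<gamma>)) has_derivative (K \<circ> (\<lambda>s. s *\<^sub>R v))) (at t within S)"
    using v K unfolding has_vector_derivative_def
    by (intro diff_chain_within) (auto intro: has_derivative_at_withinI)
  moreover have "K \<circ> (\<lambda>s. s *\<^sub>R v) = (\<lambda>s. s *\<^sub>R K v)"
    using linear_cmul[OF has_derivative_linear[OF K]] by auto
  moreover have "openin (top_of_set S) {s \<in> S. \<gamma> s \<in> fst d}"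
    using openin_continuous_map_preimage[OF \<gamma> topological_chartD(1)[OF d(1)]] by simp
  then obtain Q where Q: "open Q" "{s \<in> S. \<gamma> s \<in> fst d} = S \<inter> Q"
    by (auto simp: openin_open)
  ultimately have deriv: "((chart_rep d e g \<circ> (snd d \<circ> \<gamma>)) has_derivative (\<lambda>s. s *\<^sub>R K v)) (at t within S)"
    by simp
  have "t \<in> Q" using t d(2) Q(2) by blast
  then obtain \<epsilon> where \<epsilon>: "\<epsilon> > 0" "ball t \<epsilon> \<subseteq> Q" using Q(1) open_contains_ball by blast
  have "\<gamma> s \<in> fst d" if "s \<in> S" "dist s t < \<epsilon>" for s
    using that \<epsilon>(2) Q(2) by (auto simp: dist_commute subset_iff)
  then show ?thesis
    unfolding has_vector_derivative_def using d(1)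
    by (intro has_derivative_transform_within[OF deriv \<epsilon>(1) t]) (simp add: chart_rep_def)
qed

text \<open>A notion of manifold without conditions on the transition maps, under which differentiable maps
  already compose, and which is inherited by \<^const>\<open>prod_manifold\<close> at once.\<close>

definition locally_euclidean :: "('a, 'e::euclidean_space) manifold \<Rightarrow> bool" where
  "locally_euclidean M \<longleftrightarrow> (\<forall>c\<in>mfd_atlas M. topological_chart (mfd_topology M) c) \<and>
     \<Union> (fst ` mfd_atlas M) = points M"

lemma smooth_manifold_imp_locally_euclidean: "smooth_manifold M \<Longrightarrow> locally_euclidean M"
  by (simp add: smooth_manifold_def locally_euclidean_def)

lemma locally_euclidean_chart:
  assumes "locally_euclidean M" "c \<in> mfd_atlas M"
  shows "topological_chart (mfd_topology M) c"
  using assms by (simp add: locally_euclidean_def)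

lemma chart_at:
  assumes "locally_euclidean M" "p \<in> points M"
  shows "chart_at M p \<in> mfd_atlas M" "p \<in> fst (chart_at M p)"
proof -
  have "\<exists>c. c \<in> mfd_atlas M \<and> p \<in> fst c"
    using assms unfolding locally_euclidean_def by blast
  then show "chart_at M p \<in> mfd_atlas M" "p \<in> fst (chart_at M p)"
    unfolding chart_at_def by (metis (mono_tags, lifting) someI_ex)+
qed

text \<open>Tangent maps and their chain rule need differentiability only, and differentiability passes through
  products and composites of manifolds with far less effort than smoothness. Continuity is included
  so that the coordinate expressions are defined near each point.\<close>

definition differentiable_map ::
  "('a, 'e::euclidean_space) manifold \<Rightarrow> ('b, 'f::euclidean_space) manifold \<Rightarrow> ('a \<Rightarrow> 'b) \<Rightarrow> bool" where
  "differentiable_map M N f \<longleftrightarrow> continuous_map (mfd_topology M) (mfd_topology N) f \<and>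
     (\<forall>c\<in>mfd_atlas M. \<forall>d\<in>mfd_atlas N. \<forall>p\<in>fst c.
        f p \<in> fst d \<longrightarrow> chart_rep c d f differentiable (at (snd c p)))"

lemma differentiable_mapD:
  assumes "differentiable_map M N f" "c \<in> mfd_atlas M" "d \<in> mfd_atlas N" "p \<in> fst c" "f p \<in> fst d"
  obtains L where "(chart_rep c d f has_derivative L) (at (snd c p))"
  using assms unfolding differentiable_map_def differentiable_def by blast

lemma smooth_on_open_imp_differentiable:
  assumes "smooth_on S f" "open S" "x \<in> S"
  shows "f differentiable (at x)"
proof -
  have "Ck_on (Suc 0) S f" using assms(1) unfolding smooth_on_def by blast
  then have "f differentiable (at x within S)"
    using assms(3) by (auto simp: differentiable_on_def)
  then show ?thesis using at_within_open[OF assms(3,2)] by metis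
qed

lemma smooth_map_domain:
  assumes "locally_euclidean M" "locally_euclidean N" "continuous_map (mfd_topology M) (mfd_topology N) f"
    and "c \<in> mfd_atlas M" "d \<in> mfd_atlas N"
  shows "open (snd c ` (fst c \<inter> f -` fst d))"
proof -
  note D = topological_chartD[OF locally_euclidean_chart[OF assms(1,4)]]
  have "openin (mfd_topology M) {x \<in> points M. f x \<in> fst d}"
    using assms(3) topological_chartD(1)[OF locally_euclidean_chart[OF assms(2,5)]]
    by (rule openin_continuous_map_preimage)
  moreover have "fst c \<inter> f -` fst d = fst c \<inter> {x \<in> points M. f x \<in> fst d}"
    using openin_subset[OF D(1)] by blast
  ultimately show ?thesis using D(3) by simp
qed

lemma smooth_map_imp_differentiable_map:
  assumes "locally_euclidean M" "locally_euclidean N" "smooth_map M N f"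
  shows "differentiable_map M N f"
  unfolding differentiable_map_def
proof (intro conjI ballI impI)
  show cont: "continuous_map (mfd_topology M) (mfd_topology N) f"
    using assms(3) by (simp add: smooth_map_def)
  fix c d p assume cd: "c \<in> mfd_atlas M" "d \<in> mfd_atlas N" and p: "p \<in> fst c" "f p \<in> fst d"
  have "smooth_on (snd c ` (fst c \<inter> f -` fst d)) (chart_rep c d f)"
    using assms(3) cd unfolding smooth_map_def chart_rep_def by fastforce
  then show "chart_rep c d f differentiable (at (snd c p))"
    using smooth_map_domain[OF assms(1,2) cont cd] p
    by (intro smooth_on_open_imp_differentiable) auto
qed

lemma differentiable_map_compose:
  assumes "locally_euclidean M" "locally_euclidean N"
    and f: "differentiable_map M N f" and g: "differentiable_map N P g"
  shows "differentiable_map M P (g \<circ> f)"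
  unfolding differentiable_map_def
proof (intro conjI ballI impI)
  have cont: "continuous_map (mfd_topology M) (mfd_topology N) f"
    using f by (simp add: differentiable_map_def)
  then show "continuous_map (mfd_topology M) (mfd_topology P) (g \<circ> f)"
    using g continuous_map_compose by (auto simp: differentiable_map_def)
  fix c e p assume c: "c \<in> mfd_atlas M" "p \<in> fst c" and e: "e \<in> mfd_atlas P" "(g \<circ> f) p \<in> fst e"
  have tc: "topological_chart (mfd_topology M) c"
    using c(1) assms(1) by (simp add: locally_euclidean_def)
  have "f p \<in> points N"
    using cont c(2) openin_subset[OF topological_chartD(1)[OF tc]]
    by (auto simp: continuous_map_def)
  then obtain d where d: "d \<in> mfd_atlas N" "f p \<in> fst d"
    using chart_at[OF assms(2)] by blast
  obtain L where L: "(chart_rep c d f has_derivative L) (at (snd c p))"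
    using differentiable_mapD[OF f c(1) d(1) c(2) d(2)] .
  obtain K where K: "(chart_rep d e g has_derivative K) (at (snd d (f p)))"
    using differentiable_mapD[OF g d(1) e(1) d(2)] e(2) by auto
  show "chart_rep c e (g \<circ> f) differentiable (at (snd c p))"
    unfolding differentiable_def
    using has_derivative_chart_rep_compose[OF tc c(2) _ d(2) cont L K] d(1) assms(2)
    by (auto simp: locally_euclidean_def)
qed

lemma differentiable_map_const:
  "k \<in> points N \<Longrightarrow> differentiable_map M N (\<lambda>x. k)"
  by (auto simp: differentiable_map_def chart_rep_def o_def)

text \<open>In coordinates the identity is a transition map.\<close>

lemma differentiable_map_id:
  assumes "smooth_manifold M"
  shows "differentiable_map M M (\<lambda>x. x)"
proof (rule smooth_map_imp_differentiable_map)
  show "locally_euclidean M" "locally_euclidean M"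
    using assms by (simp_all add: smooth_manifold_imp_locally_euclidean)
  have "smooth_on (snd c ` (fst c \<inter> fst d)) (snd d \<circ> inv_into (fst c) (snd c))"
    if "c \<in> mfd_atlas M" "d \<in> mfd_atlas M" for c d
    using assms that unfolding smooth_manifold_def smooth_transition_def by (auto simp: case_prod_beta)
  then show "smooth_map M M (\<lambda>x. x)"
    by (fastforce simp: smooth_map_def o_def)
qed

lemma topological_chart_prod:
  assumes "topological_chart X c" "topological_chart Y d"
  shows "topological_chart (prod_topology X Y) (fst c \<times> fst d, map_prod (snd c) (snd d))"
proof -
  obtain U \<xi> V \<psi> where cd: "c = (U, \<xi>)" "d = (V, \<psi>)" by force
  have U: "openin X U" "open (\<xi> ` U)" "homeomorphic_map (subtopology X U) (top_of_set (\<xi> ` U)) \<xi>"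
   and V: "openin Y V" "open (\<psi> ` V)" "homeomorphic_map (subtopology Y V) (top_of_set (\<psi> ` V)) \<psi>"
    using assms by (auto simp: cd topological_chart_def)
  obtain f g where "homeomorphic_maps (subtopology X U) (top_of_set (\<xi> ` U)) \<xi> f"
     "homeomorphic_maps (subtopology Y V) (top_of_set (\<psi> ` V)) \<psi> g"
    using U(3) V(3) unfolding homeomorphic_map_maps by blast
  then have "homeomorphic_maps (prod_topology (subtopology X U) (subtopology Y V))
     (prod_topology (top_of_set (\<xi> ` U)) (top_of_set (\<psi> ` V))) (\<lambda>(x, y). (\<xi> x, \<psi> y)) (\<lambda>(x, y). (f x, g y))"
    unfolding homeomorphic_maps_prod by blast
  then have "homeomorphic_map (prod_topology (subtopology X U) (subtopology Y V))
     (prod_topology (top_of_set (\<xi> ` U)) (top_of_set (\<psi> ` V))) (map_prod \<xi> \<psi>)"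
    unfolding homeomorphic_map_maps map_prod_def by blast
  moreover have "map_prod \<xi> \<psi> ` (U \<times> V) = \<xi> ` U \<times> \<psi> ` V" by auto
  ultimately show ?thesis
    using U V by (simp add: topological_chart_def cd openin_prod_Times_iff open_Times
        subtopology_Times)
qed

lemma prod_manifold_atlasI:
  assumes "c \<in> mfd_atlas M" "d \<in> mfd_atlas N"
  shows "(fst c \<times> fst d, map_prod (snd c) (snd d)) \<in> mfd_atlas (prod_manifold M N)"
  unfolding prod_manifold_def manifold.simps
  using assms by (intro image_eqI[where x = "(c, d)"]) (simp_all add: case_prod_beta)

lemma prod_manifold_atlasE:
  assumes "e \<in> mfd_atlas (prod_manifold M N)"
  obtains c d where "c \<in> mfd_atlas M" "d \<in> mfd_atlas N" "e = (fst c \<times> fst d, map_prod (snd c) (snd d))"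
  using assms unfolding prod_manifold_def manifold.simps by (auto simp: case_prod_beta)

lemma locally_euclidean_prod:
  assumes "locally_euclidean M" "locally_euclidean N"
  shows "locally_euclidean (prod_manifold M N)"
proof -
  have top: "mfd_topology (prod_manifold M N) = prod_topology (mfd_topology M) (mfd_topology N)"
    by (simp add: prod_manifold_def)
  have "topological_chart (mfd_topology (prod_manifold M N)) e" if "e \<in> mfd_atlas (prod_manifold M N)" for e
    using prod_manifold_atlasE[OF that] assms topological_chart_prod locally_euclidean_chart top by metis
  moreover have "\<Union> (fst ` mfd_atlas (prod_manifold M N)) = \<Union> (fst ` mfd_atlas M) \<times> \<Union> (fst ` mfd_atlas N)"
  proof (intro equalityI subsetI)
    fix p assume "p \<in> \<Union> (fst ` mfd_atlas (prod_manifold M N))"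
    then obtain e where "e \<in> mfd_atlas (prod_manifold M N)" "p \<in> fst e" by blast
    then show "p \<in> \<Union> (fst ` mfd_atlas M) \<times> \<Union> (fst ` mfd_atlas N)"
      by (elim prod_manifold_atlasE) (cases p, auto)
  next
    fix p assume "p \<in> \<Union> (fst ` mfd_atlas M) \<times> \<Union> (fst ` mfd_atlas N)"
    then obtain c d where "c \<in> mfd_atlas M" "d \<in> mfd_atlas N" "p \<in> fst c \<times> fst d"
      by (cases p) auto
    then show "p \<in> \<Union> (fst ` mfd_atlas (prod_manifold M N))"
      using prod_manifold_atlasI[of c M d N] by (metis UN_iff fst_conv)
  qed
  ultimately show ?thesis using assms by (simp add: locally_euclidean_def top)
qed

lemma chart_rep_pair:
  assumes "(chart_rep c d f has_derivative L) (at u)" "(chart_rep c e g has_derivative K) (at u)"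
  shows "(chart_rep c (fst d \<times> fst e, map_prod (snd d) (snd e)) (\<lambda>x. (f x, g x)) has_derivative
    (\<lambda>v. (L v, K v))) (at u)"
  using has_derivative_Pair[OF assms] by (simp add: chart_rep_def o_def)

lemma differentiable_map_pair:
  assumes f: "differentiable_map M N f" and g: "differentiable_map M P g"
  shows "differentiable_map M (prod_manifold N P) (\<lambda>x. (f x, g x))"
  unfolding differentiable_map_def
proof (intro conjI ballI impI)
  show "continuous_map (mfd_topology M) (mfd_topology (prod_manifold N P)) (\<lambda>x. (f x, g x))"
    using f g by (simp add: prod_manifold_def differentiable_map_def continuous_map_paired)
  fix c e p assume c: "c \<in> mfd_atlas M" "p \<in> fst c" and e: "e \<in> mfd_atlas (prod_manifold N P)"
    "(f p, g p) \<in> fst e"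
  obtain d1 d2 where d: "d1 \<in> mfd_atlas N" "d2 \<in> mfd_atlas P"
    "e = (fst d1 \<times> fst d2, map_prod (snd d1) (snd d2))"
    using prod_manifold_atlasE[OF e(1)] .
  then obtain L K where "(chart_rep c d1 f has_derivative L) (at (snd c p))"
    "(chart_rep c d2 g has_derivative K) (at (snd c p))"
    using differentiable_mapD[OF f c(1) _ c(2)] differentiable_mapD[OF g c(1) _ c(2)] e(2)
    by (metis fst_conv mem_Times_iff snd_conv)
  from chart_rep_pair[OF this]
  show "chart_rep c e (\<lambda>x. (f x, g x)) differentiable (at (snd c p))"
    unfolding differentiable_def d(3) by blast
qed

lemma inv_into_prod_chart:
  assumes c: "topological_chart X c" and d: "topological_chart Y d" and uv: "u \<in> snd c ` fst c" "v \<in> snd d ` fst d"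
  shows "inv_into (fst c \<times> fst d) (map_prod (snd c) (snd d)) (u, v) =
    (inv_into (fst c) (snd c) u, inv_into (fst d) (snd d) v)"
proof -
  have "inj_on (map_prod (snd c) (snd d)) (fst c \<times> fst d)"
    using topological_chartD(2)[OF c] topological_chartD(2)[OF d] by (rule map_prod_inj_on)
  then show ?thesis
    using uv by (intro inv_into_f_eq) (auto simp: inv_into_into f_inv_into_f)
qed

text \<open>In coordinates, a projection followed by a transition map: the chart of the target need not be the
  factor of the product chart.\<close>

lemma differentiable_map_fst:
  assumes M: "smooth_manifold M" and N: "locally_euclidean N"
  shows "differentiable_map (prod_manifold M N) M fst"
  unfolding differentiable_map_def
proof (intro conjI ballI impI)
  show "continuous_map (mfd_topology (prod_manifold M N)) (mfd_topology M) fst"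
    by (simp add: prod_manifold_def continuous_map_fst)
  fix e k p assume e: "e \<in> mfd_atlas (prod_manifold M N)" "p \<in> fst e" and k: "k \<in> mfd_atlas M" "fst p \<in> fst k"
  obtain c d where cd: "c \<in> mfd_atlas M" "d \<in> mfd_atlas N" "e = (fst c \<times> fst d, map_prod (snd c) (snd d))"
    using prod_manifold_atlasE[OF e(1)] .
  obtain a b where p: "p = (a, b)" "a \<in> fst c" "b \<in> fst d" using e(2) cd(3) by auto
  have tc: "topological_chart (mfd_topology M) c" and td: "topological_chart (mfd_topology N) d"
    using cd M N by (simp_all add: smooth_manifold_imp_locally_euclidean locally_euclidean_chart)
  obtain L where "(chart_rep c k (\<lambda>x. x) has_derivative L) (at (snd c a))"
    using differentiable_mapD[OF differentiable_map_id[OF M] cd(1) k(1) p(2)] k(2) p(1) by auto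
  then have "((\<lambda>w. chart_rep c k (\<lambda>x. x) (fst w)) has_derivative (\<lambda>w. L (fst w))) (at (snd e p))"
    by (intro has_derivative_compose[OF has_derivative_fst[OF has_derivative_ident]]) (simp add: cd p)
  then have "(chart_rep e k fst has_derivative (\<lambda>w. L (fst w))) (at (snd e p))"
  proof (rule has_derivative_transform_within_open)
    show "open ((snd c ` fst c) \<times> (snd d ` fst d))"
      using tc td by (intro open_Times) (auto simp: topological_chart_def)
    show "snd e p \<in> snd c ` fst c \<times> snd d ` fst d" using p by (simp add: cd)
    show "chart_rep c k (\<lambda>x. x) (fst w) = chart_rep e k fst w"
      if "w \<in> snd c ` fst c \<times> snd d ` fst d" for w
      using that inv_into_prod_chart[OF tc td] by (auto simp: chart_rep_def cd(3))
  qed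
  then show "chart_rep e k fst differentiable (at (snd e p))"
    by (auto simp: differentiable_def)
qed

lemma differentiable_map_snd:
  assumes M: "locally_euclidean M" and N: "smooth_manifold N"
  shows "differentiable_map (prod_manifold M N) N snd"
  unfolding differentiable_map_def
proof (intro conjI ballI impI)
  show "continuous_map (mfd_topology (prod_manifold M N)) (mfd_topology N) snd"
    by (simp add: prod_manifold_def continuous_map_snd)
  fix e k p assume e: "e \<in> mfd_atlas (prod_manifold M N)" "p \<in> fst e" and k: "k \<in> mfd_atlas N" "snd p \<in> fst k"
  obtain c d where cd: "c \<in> mfd_atlas M" "d \<in> mfd_atlas N" "e = (fst c \<times> fst d, map_prod (snd c) (snd d))"
    using prod_manifold_atlasE[OF e(1)] .
  obtain a b where p: "p = (a, b)" "a \<in> fst c" "b \<in> fst d" using e(2) cd(3) by auto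
  have tc: "topological_chart (mfd_topology M) c" and td: "topological_chart (mfd_topology N) d"
    using cd M N by (simp_all add: smooth_manifold_imp_locally_euclidean locally_euclidean_chart)
  obtain L where "(chart_rep d k (\<lambda>x. x) has_derivative L) (at (snd d b))"
    using differentiable_mapD[OF differentiable_map_id[OF N] cd(2) k(1) p(3)] k(2) p(1) by auto
  then have "((\<lambda>w. chart_rep d k (\<lambda>x. x) (snd w)) has_derivative (\<lambda>w. L (snd w))) (at (snd e p))"
    by (intro has_derivative_compose[OF has_derivative_snd[OF has_derivative_ident]]) (simp add: cd p)
  then have "(chart_rep e k snd has_derivative (\<lambda>w. L (snd w))) (at (snd e p))"
  proof (rule has_derivative_transform_within_open)
    show "open ((snd c ` fst c) \<times> (snd d ` fst d))"
      using tc td by (intro open_Times) (auto simp: topological_chart_def)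
    show "snd e p \<in> snd c ` fst c \<times> snd d ` fst d" using p by (simp add: cd)
    show "chart_rep d k (\<lambda>x. x) (snd w) = chart_rep e k snd w"
      if "w \<in> snd c ` fst c \<times> snd d ` fst d" for w
      using that inv_into_prod_chart[OF tc td] by (auto simp: chart_rep_def cd(3))
  qed
  then show "chart_rep e k snd differentiable (at (snd e p))"
    by (auto simp: differentiable_def)
qed

lemma tangent_map_eq_chart_rep:
  "tangent_map M N f p =
     frechet_derivative (chart_rep (chart_at M p) (chart_at N (f p)) f) (at (snd (chart_at M p) p))"
  by (simp add: tangent_map_def chart_rep_def case_prod_beta Let_def)

lemma tangent_map_has_derivative:
  assumes "locally_euclidean M" "locally_euclidean N" "differentiable_map M N f" "p \<in> points M"
  shows "(chart_rep (chart_at M p) (chart_at N (f p)) f has_derivative tangent_map M N f p)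
    (at (snd (chart_at M p) p))"
proof -
  have "f p \<in> points N"
    using assms(3,4) by (auto simp: differentiable_map_def continuous_map_def)
  then have "chart_rep (chart_at M p) (chart_at N (f p)) f differentiable (at (snd (chart_at M p) p))"
    using assms(3) chart_at[OF assms(1,4)] chart_at[OF assms(2)]
    unfolding differentiable_map_def by blast
  then show ?thesis
    unfolding tangent_map_eq_chart_rep by (simp add: frechet_derivative_works)
qed

lemma tangent_map_linear:
  assumes "locally_euclidean M" "locally_euclidean N" "differentiable_map M N f" "p \<in> points M"
  shows "linear (tangent_map M N f p)"
  using tangent_map_has_derivative[OF assms] by (rule has_derivative_linear)

section \<open>Smooth curves and their reparametrisations\<close>

lemma smooth_curve_domain:
  assumes "locally_euclidean M" "smooth_curve M c" "d \<in> mfd_atlas M"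
  shows "openin (top_of_set {0..1}) ({0..1} \<inter> c -` fst d)"
proof -
  have "openin (top_of_set {0..1}) {t \<in> topspace (top_of_set {0..1}). c t \<in> fst d}"
    using assms(2) topological_chartD(1)[OF locally_euclidean_chart[OF assms(1,3)]]
    unfolding smooth_curve_def by (blast intro: openin_continuous_map_preimage)
  moreover have "{t \<in> topspace (top_of_set {0..1}). c t \<in> fst d} = {0..1} \<inter> c -` fst d" by auto
  ultimately show ?thesis by simp
qed

lemma smooth_curve_points:
  assumes "smooth_curve M c" "t \<in> {0..1}"
  shows "c t \<in> points M"
  using assms by (auto simp: smooth_curve_def continuous_map_def)

lemma smooth_curve_differentiable:
  assumes M: "locally_euclidean M" and c: "smooth_curve M c"
    and d: "d \<in> mfd_atlas M" and t: "t \<in> {0..1}" "c t \<in> fst d"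
  shows "(snd d \<circ> c) differentiable (at t within {0..1})"
proof -
  let ?T = "{0..1} \<inter> c -` fst d"
  have "smooth_on ?T (snd d \<circ> c)"
    using c d unfolding smooth_curve_def by fastforce
  then have "Ck_on (Suc 0) ?T (snd d \<circ> c)" unfolding smooth_on_def by blast
  then have "(snd d \<circ> c) differentiable (at t within ?T)"
    using t by (simp add: differentiable_on_def)
  then show ?thesis
    using at_within_openin[OF smooth_curve_domain[OF M c d]] t by simp
qed

lemma velocity_eqI:
  assumes "((snd (chart_at M (c t)) \<circ> c) has_vector_derivative v) (at t within {0..1})" "t \<in> {0..1}"
  shows "velocity M c t = v"
  unfolding velocity_def
  using vector_derivative_within_closed_interval[of 0 1 t] assms by simp

lemma velocity_has_vector_derivative:
  assumes M: "locally_euclidean M" and c: "smooth_curve M c" and t: "t \<in> {0..1}"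
  shows "((snd (chart_at M (c t)) \<circ> c) has_vector_derivative velocity M c t) (at t within {0..1})"
  using smooth_curve_differentiable[OF M c _ t] chart_at[OF M smooth_curve_points[OF c t]]
  unfolding velocity_def by (simp add: vector_derivative_works)

lemma Diff_plus_maps_to: "\<phi> \<in> Diff_plus \<Longrightarrow> t \<in> {0..1} \<Longrightarrow> \<phi> t \<in> {0..1}"
  unfolding Diff_plus_def by (blast dest: bij_betwE)

lemma Diff_plus_derivative:
  assumes "\<phi> \<in> Diff_plus" "t \<in> {0..1}"
  shows "(\<phi> has_vector_derivative vector_derivative \<phi> (at t within {0..1})) (at t within {0..1})"
    and "vector_derivative \<phi> (at t within {0..1}) > 0"
proof -
  have "Ck_on (Suc 0) {0..1} \<phi>" using assms unfolding Diff_plus_def smooth_on_def by blast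
  then show "(\<phi> has_vector_derivative vector_derivative \<phi> (at t within {0..1})) (at t within {0..1})"
    using assms(2) by (simp add: differentiable_on_def vector_derivative_works)
  show "vector_derivative \<phi> (at t within {0..1}) > 0" using assms unfolding Diff_plus_def by blast
qed

text \<open>By the mean value theorem \<open>\<phi>\<close> is nondecreasing, so \<open>\<phi> 0\<close> is at most the value \<open>0\<close>, which \<open>\<phi>\<close> takes.\<close>

lemma Diff_plus_0:
  assumes "\<phi> \<in> Diff_plus"
  shows "\<phi> 0 = 0"
proof -
  have "\<phi> ` {0..1} = {0..1}" using assms unfolding Diff_plus_def bij_betw_def by blast
  then have "0 \<in> \<phi> ` {0..1}" by simp
  then obtain s where s: "s \<in> {0..1}" "\<phi> s = 0" by force
  have "\<exists>x\<in>{0..s}. \<phi> s - \<phi> 0 = (s - 0) *\<^sub>R vector_derivative \<phi> (at x within {0..1})"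
  proof (rule mvt_very_simple)
    show "0 \<le> s" using s by simp
    fix x assume "0 \<le> x" "x \<le> s"
    then have "(\<phi> has_vector_derivative vector_derivative \<phi> (at x within {0..1})) (at x within {0..s})"
      using s by (intro has_vector_derivative_within_subset[OF Diff_plus_derivative(1)[OF assms]]) auto
    then show "(\<phi> has_derivative (\<lambda>y. y *\<^sub>R vector_derivative \<phi> (at x within {0..1}))) (at x within {0..s})"
      by (simp add: has_vector_derivative_def)
  qed
  then obtain x where x: "x \<in> {0..s}" "- \<phi> 0 = s * vector_derivative \<phi> (at x within {0..1})"
    using s(2) by auto
  have "vector_derivative \<phi> (at x within {0..1}) > 0"
    using x(1) s(1) by (intro Diff_plus_derivative(2)[OF assms]) auto
  then have "s * vector_derivative \<phi> (at x within {0..1}) \<ge> 0" using s(1) by auto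
  then show ?thesis using Diff_plus_maps_to[OF assms, of 0] x(2) by auto
qed

lemma Diff_plus_compose_derivative:
  fixes f :: "real \<Rightarrow> 'a::real_normed_vector"
  assumes \<phi>: "\<phi> \<in> Diff_plus" and t: "t \<in> {0..1}"
    and f: "(f has_vector_derivative v) (at (\<phi> t) within {0..1})"
  shows "((f \<circ> \<phi>) has_vector_derivative vector_derivative \<phi> (at t within {0..1}) *\<^sub>R v) (at t within {0..1})"
proof -
  have "\<phi> ` {0..1} \<subseteq> {0..1}" using Diff_plus_maps_to[OF \<phi>] by blast
  then show ?thesis
    using vector_diff_chain_within[OF Diff_plus_derivative(1)[OF \<phi> t]]
      has_vector_derivative_within_subset[OF f] by blast
qed

text \<open>The derivative of the inverse is determined, and is positive, by the chain rule for \<open>\<phi> \<circ> \<psi> = id\<close>.\<close>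

lemma Diff_plus_inverse:
  assumes \<phi>: "\<phi> \<in> Diff_plus"
  defines "\<psi> \<equiv> inv_into {0..1} \<phi>"
  shows "\<psi> \<in> Diff_plus"
    and "t \<in> {0..1} \<Longrightarrow> \<phi> (\<psi> t) = t"
    and "t \<in> {0..1} \<Longrightarrow>
      vector_derivative \<psi> (at t within {0..1}) * vector_derivative \<phi> (at (\<psi> t) within {0..1}) = 1"
proof -
  have b: "bij_betw \<phi> {0..1} {0..1}" and sm: "smooth_on {0..1} \<phi>" "smooth_on {0..1} \<psi>"
    using \<phi> by (auto simp: Diff_plus_def \<psi>_def)
  have b': "bij_betw \<psi> {0..1} {0..1}" unfolding \<psi>_def by (rule bij_betw_inv_into[OF b])
  show inv: "\<phi> (\<psi> t) = t" if "t \<in> {0..1}" for t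
    using b that unfolding \<psi>_def by (rule bij_betw_inv_into_right)
  have "\<phi> t = inv_into {0..1} \<psi> t" if "t \<in> {0..1}" for t
    using b b' that unfolding \<psi>_def by (metis inv_into_inv_into_eq)
  then have sm': "smooth_on {0..1} (inv_into {0..1} \<psi>)"
    using sm(1) Ck_on_cong unfolding smooth_on_def by blast
  have d: "(\<psi> has_vector_derivative vector_derivative \<psi> (at t within {0..1})) (at t within {0..1})"
    if "t \<in> {0..1}" for t
  proof -
    have "Ck_on (Suc 0) {0..1} \<psi>" using sm(2) unfolding smooth_on_def by blast
    then show ?thesis using that by (simp add: differentiable_on_def vector_derivative_works)
  qed
  show prod: "vector_derivative \<psi> (at t within {0..1}) * vector_derivative \<phi> (at (\<psi> t) within {0..1}) = 1"
    if t: "t \<in> {0..1}" for t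
  proof -
    have im: "\<psi> ` {0..1} = {0..1}" using b' by (simp add: bij_betw_def)
    then have "\<psi> t \<in> {0..1}" using t by blast
    then have "((\<phi> \<circ> \<psi>) has_vector_derivative
       vector_derivative \<psi> (at t within {0..1}) *\<^sub>R vector_derivative \<phi> (at (\<psi> t) within {0..1})) (at t within {0..1})"
      using im by (intro vector_diff_chain_within d t) (simp add: Diff_plus_derivative(1)[OF \<phi>])
    moreover have "((\<lambda>t. t) has_vector_derivative 1) (at t within {0..1})"
      by (rule has_vector_derivative_id)
    then have "((\<phi> \<circ> \<psi>) has_vector_derivative 1) (at t within {0..1})"
      by (rule has_vector_derivative_transform[OF t, rotated]) (simp add: inv)
    ultimately show ?thesis
      using vector_derivative_unique_within_closed_interval[of 0 1 t] t by fastforce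
  qed
  have "vector_derivative \<psi> (at t within {0..1}) > 0" if t: "t \<in> {0..1}" for t
  proof -
    have "\<psi> t \<in> {0..1}" using b' t by (blast dest: bij_betwE)
    from Diff_plus_derivative(2)[OF \<phi> this] prod[OF t] show ?thesis
      by (metis zero_less_mult_pos2 zero_less_one)
  qed
  then show "\<psi> \<in> Diff_plus" using b' sm(2) sm' by (simp add: Diff_plus_def)
qed

lemma smooth_curve_reparametrise:
  assumes M: "locally_euclidean M" and c: "smooth_curve M c" and \<phi>: "\<phi> \<in> Diff_plus"
  shows "smooth_curve M (c \<circ> \<phi>)"
  unfolding smooth_curve_def
proof (intro conjI ballI)
  have "continuous_on {0..1} \<phi>"
    using \<phi> unfolding Diff_plus_def smooth_on_def by (metis (no_types, lifting) Ck_on.simps(1) mem_Collect_eq)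
  then have "continuous_map (top_of_set {0..1}) (top_of_set {0..1}) \<phi>"
    using Diff_plus_maps_to[OF \<phi>] by (auto simp: continuous_map_in_subtopology)
  then show cont: "continuous_map (top_of_set {0..1}) (mfd_topology M) (c \<circ> \<phi>)"
    using c continuous_map_compose unfolding smooth_curve_def by blast
  fix d assume d: "d \<in> mfd_atlas M"
  obtain U \<xi> where d_eq: "d = (U, \<xi>)" by force
  let ?T = "{0..1} \<inter> (c \<circ> \<phi>) -` U" and ?S = "{0..1} \<inter> c -` U"
  have "openin (top_of_set {0..1}) {t \<in> topspace (top_of_set {0..1}). (c \<circ> \<phi>) t \<in> U}"
    using topological_chartD(1)[OF locally_euclidean_chart[OF M d]]
    by (intro openin_continuous_map_preimage[OF cont]) (simp add: d_eq)
  moreover have "{t \<in> topspace (top_of_set {0..1}). (c \<circ> \<phi>) t \<in> U} = ?T" by auto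
  ultimately have T: "openin (top_of_set {0..1}) ?T" by simp
  have "Ck_on k ?T ((\<xi> \<circ> c) \<circ> \<phi>)" for k
  proof (rule Ck_on_compose_real[OF T])
    show "Ck_on k ?T \<phi>"
      using \<phi> Ck_on_openin_subset[OF _ T] unfolding Diff_plus_def smooth_on_def by blast
    show "Ck_on k ?S (\<xi> \<circ> c)"
      using c d unfolding smooth_curve_def smooth_on_def d_eq by blast
    show "\<phi> ` ?T \<subseteq> ?S" using Diff_plus_maps_to[OF \<phi>] by auto
  qed
  then show "case d of (U, \<xi>) \<Rightarrow> smooth_on ({0..1} \<inter> (c \<circ> \<phi>) -` U) (\<xi> \<circ> (c \<circ> \<phi>))"
    by (simp add: d_eq smooth_on_def o_assoc)
qed

lemma velocity_reparametrise:
  assumes M: "locally_euclidean M" and c: "smooth_curve M c" and \<phi>: "\<phi> \<in> Diff_plus"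
    and t: "t \<in> {0..1}"
  shows "velocity M (c \<circ> \<phi>) t = vector_derivative \<phi> (at t within {0..1}) *\<^sub>R velocity M c (\<phi> t)"
proof (rule velocity_eqI[OF _ t])
  show "((snd (chart_at M ((c \<circ> \<phi>) t)) \<circ> (c \<circ> \<phi>)) has_vector_derivative
      vector_derivative \<phi> (at t within {0..1}) *\<^sub>R velocity M c (\<phi> t)) (at t within {0..1})"
    using Diff_plus_compose_derivative[OF \<phi> t
        velocity_has_vector_derivative[OF M c Diff_plus_maps_to[OF \<phi> t]]]
    unfolding comp_assoc comp_apply[of c \<phi> t] .
qed

text \<open>Inside one chart the curve is constant near each time, and the unit interval is connected.\<close>

lemma curve_constant_if_velocity_zero:
  assumes M: "locally_euclidean M" and c: "continuous_map (top_of_set {0..1}) (mfd_topology M) c"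
    and zero: "\<And>d t. d \<in> mfd_atlas M \<Longrightarrow> t \<in> {0..1} \<Longrightarrow> c t \<in> fst d \<Longrightarrow>
      ((snd d \<circ> c) has_vector_derivative 0) (at t within {0..1})"
    and t: "t \<in> {0..1}"
  shows "c t = c 0"
proof (rule connected_local_const[of "{0..1}"])
  show "\<forall>a\<in>{0..1}. eventually (\<lambda>b. c a = c b) (at a within {0..1})"
  proof
    fix a :: real assume a: "a \<in> {0..1}"
    have "c a \<in> points M" using c a by (auto simp: continuous_map_def)
    then obtain d where d: "d \<in> mfd_atlas M" "c a \<in> fst d" using chart_at[OF M] by blast
    note D = topological_chartD[OF locally_euclidean_chart[OF M d(1)]]
    have "openin (top_of_set {0..1}) {t \<in> topspace (top_of_set {0..1}). c t \<in> fst d}"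
      by (rule openin_continuous_map_preimage[OF c D(1)])
    then obtain Q where Q: "open Q" "{t \<in> {0..1}. c t \<in> fst d} = {0..1} \<inter> Q"
      by (auto simp: openin_open)
    then have "a \<in> Q" using a d(2) by blast
    then obtain \<epsilon> where \<epsilon>: "\<epsilon> > 0" "ball a \<epsilon> \<subseteq> Q" using Q(1) open_contains_ball by blast
    let ?J = "{0..1} \<inter> ball a \<epsilon>"
    have J: "c s \<in> fst d" if "s \<in> ?J" for s using that \<epsilon>(2) Q(2) by blast
    have "\<exists>k. \<forall>s\<in>?J. (snd d \<circ> c) s = k"
    proof (rule has_derivative_zero_constant)
      show "convex ?J" by (intro convex_Int convex_ball) simp
      fix s assume s: "s \<in> ?J"
      have "((snd d \<circ> c) has_derivative (\<lambda>h. 0)) (at s within {0..1})"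
        using zero[OF d(1) _ J[OF s]] s by (simp add: has_vector_derivative_def)
      then show "((snd d \<circ> c) has_derivative (\<lambda>h. 0)) (at s within ?J)"
        by (rule has_derivative_subset) simp
    qed
    moreover have "a \<in> ?J" using a \<epsilon>(1) by simp
    ultimately have "c a = c s" if "s \<in> ?J" for s
      using D(2) J that by (metis comp_apply inj_onD)
    then show "eventually (\<lambda>b. c a = c b) (at a within {0..1})"
      unfolding eventually_at using \<epsilon>(1)
      by (intro exI[of _ \<epsilon>]) (auto simp: dist_commute)
  qed
qed (use t in auto)

section \<open>Lie groups and uniqueness of the evolution\<close>

locale lie_group_manifold = group G
  for G :: "'g monoid" (structure) and MG :: "('g, 'e::euclidean_space) manifold" +
  assumes lie_group: "lie_group G MG"
begin

lemma smooth_manifold: "smooth_manifold MG" and points: "points MG = carrier G"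
  using lie_group by (simp_all add: lie_group_def)

lemma locally_euclidean: "locally_euclidean MG"
  by (rule smooth_manifold_imp_locally_euclidean[OF smooth_manifold])

lemma differentiable_mult:
  assumes "locally_euclidean N" "differentiable_map N MG f" "differentiable_map N MG g"
  shows "differentiable_map N MG (\<lambda>x. f x \<otimes> g x)"
proof -
  have "differentiable_map (prod_manifold MG MG) MG (\<lambda>(x, y). x \<otimes> y)"
    using lie_group locally_euclidean locally_euclidean_prod
    by (intro smooth_map_imp_differentiable_map) (auto simp: lie_group_def)
  from differentiable_map_compose[OF assms(1) locally_euclidean_prod[OF locally_euclidean locally_euclidean]
      differentiable_map_pair[OF assms(2,3)] this]
  show ?thesis by (simp add: o_def)
qed

lemma differentiable_inv:
  assumes "locally_euclidean N" "differentiable_map N MG f"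
  shows "differentiable_map N MG (\<lambda>x. inv (f x))"
proof -
  have "differentiable_map MG MG (\<lambda>x. inv x)"
    using lie_group locally_euclidean
    by (intro smooth_map_imp_differentiable_map) (auto simp: lie_group_def)
  from differentiable_map_compose[OF assms(1) locally_euclidean assms(2) this]
  show ?thesis by (simp add: o_def)
qed

lemma differentiable_left_mult: "a \<in> carrier G \<Longrightarrow> differentiable_map MG MG (\<lambda>x. a \<otimes> x)"
  and differentiable_right_mult: "a \<in> carrier G \<Longrightarrow> differentiable_map MG MG (\<lambda>x. x \<otimes> a)"
  using locally_euclidean smooth_manifold
  by (auto intro!: differentiable_mult differentiable_map_const differentiable_map_id simp: points)

lemma linear_Ad:
  assumes "g \<in> carrier G"
  shows "linear (Ad G MG g)"
proof -
  have "differentiable_map MG MG (\<lambda>x. g \<otimes> x \<otimes> inv g)"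
    using assms locally_euclidean smooth_manifold
    by (auto intro!: differentiable_mult differentiable_map_const differentiable_map_id simp: points)
  then show ?thesis unfolding Ad_def
    by (rule tangent_map_linear[OF locally_euclidean locally_euclidean]) (simp add: points)
qed

lemma linear_tangent_right_mult:
  "a \<in> carrier G \<Longrightarrow> linear (tangent_map MG MG (\<lambda>x. x \<otimes> a) \<one>)"
  by (rule tangent_map_linear[OF locally_euclidean locally_euclidean differentiable_right_mult])
     (simp_all add: points)

lemma evolution_carrier: "is_evolution G MG q g \<Longrightarrow> t \<in> {0..1} \<Longrightarrow> g t \<in> carrier G"
  using smooth_curve_points points unfolding is_evolution_def by blast

text \<open>Let \<open>F (x, y) = inv x \<otimes> y\<close>. For fixed \<open>t\<close> the map \<open>x \<mapsto> F (x \<otimes> g1 t, x \<otimes> g2 t)\<close> is constant, so the derivative of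
  \<open>F\<close> at \<open>(g1 t, g2 t)\<close> vanishes on all pairs of right translates of one Lie algebra element. The
  velocity of \<open>(g1, g2)\<close> at \<open>t\<close> is the pair of right translates of \<open>q t\<close>.\<close>

lemma evolution_quotient_velocity_zero:
  assumes g1: "is_evolution G MG q g1" and g2: "is_evolution G MG q g2" and t: "t \<in> {0..1}"
    and e: "e \<in> mfd_atlas MG" "inv (g1 t) \<otimes> g2 t \<in> fst e"
  shows "((snd e \<circ> (\<lambda>t. inv (g1 t) \<otimes> g2 t)) has_vector_derivative 0) (at t within {0..1})"
proof -
  let ?P = "prod_manifold MG MG"
  define F where "F = (\<lambda>p. inv (fst p) \<otimes> snd p)"
  define j where "j = (\<lambda>x. (x \<otimes> g1 t, x \<otimes> g2 t))"
  let ?b = "chart_at MG \<one>" and ?d1 = "chart_at MG (g1 t)" and ?d2 = "chart_at MG (g2 t)"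
  let ?d = "(fst ?d1 \<times> fst ?d2, map_prod (snd ?d1) (snd ?d2))"
  define v where "v = (velocity MG g1 t, velocity MG g2 t)"
  note le = locally_euclidean and leP = locally_euclidean_prod[OF locally_euclidean locally_euclidean]
  have gt: "g1 t \<in> carrier G" "g2 t \<in> carrier G"
    using evolution_carrier[OF g1 t] evolution_carrier[OF g2 t] .
  have sm: "smooth_curve MG g1" "smooth_curve MG g2" using g1 g2 by (simp_all add: is_evolution_def)
  have b: "?b \<in> mfd_atlas MG" "\<one> \<in> fst ?b" by (rule chart_at[OF le]; simp add: points)+
  have d1: "?d1 \<in> mfd_atlas MG" "g1 t \<in> fst ?d1" and d2: "?d2 \<in> mfd_atlas MG" "g2 t \<in> fst ?d2"
    using gt by (auto intro!: chart_at[OF le] simp: points)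
  have d: "?d \<in> mfd_atlas ?P" "(g1 t, g2 t) \<in> fst ?d"
    using prod_manifold_atlasI[OF d1(1) d2(1)] d1(2) d2(2) by simp_all
  have F: "differentiable_map ?P MG F"
    unfolding F_def using leP le smooth_manifold
    by (intro differentiable_mult differentiable_inv differentiable_map_fst differentiable_map_snd)
  obtain L where L: "(chart_rep ?d e F has_derivative L) (at (snd ?d (g1 t, g2 t)))"
    using differentiable_mapD[OF F d(1) e(1) d(2)] e(2) by (auto simp: F_def)
  have \<gamma>: "continuous_map (top_of_set {0..1}) (mfd_topology ?P) (\<lambda>s. (g1 s, g2 s))"
    using sm by (simp add: prod_manifold_def smooth_curve_def continuous_map_paired)
  have "((\<lambda>s. ((snd ?d1 \<circ> g1) s, (snd ?d2 \<circ> g2) s)) has_vector_derivative v) (at t within {0..1})"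
    unfolding v_def using sm t le by (intro has_vector_derivative_Pair velocity_has_vector_derivative)
  then have "((snd ?d \<circ> (\<lambda>s. (g1 s, g2 s))) has_vector_derivative v) (at t within {0..1})"
    by (simp add: o_def)
  from has_vector_derivative_chart_rep_compose[OF locally_euclidean_chart[OF leP d(1)] _ \<gamma> t this L] d(2)
  have "((snd e \<circ> (F \<circ> (\<lambda>s. (g1 s, g2 s)))) has_vector_derivative L v) (at t within {0..1})"
    by simp
  moreover have "L v = 0"
  proof -
    define R1 where "R1 = tangent_map MG MG (\<lambda>x. x \<otimes> g1 t) \<one>"
    define R2 where "R2 = tangent_map MG MG (\<lambda>x. x \<otimes> g2 t) \<one>"
    have v: "v = (R1 (q t), R2 (q t))"
      using g1 g2 t by (simp add: v_def R1_def R2_def is_evolution_def)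
    have "(chart_rep ?b (chart_at MG (\<one> \<otimes> g1 t)) (\<lambda>x. x \<otimes> g1 t) has_derivative R1) (at (snd ?b \<one>))"
         "(chart_rep ?b (chart_at MG (\<one> \<otimes> g2 t)) (\<lambda>x. x \<otimes> g2 t) has_derivative R2) (at (snd ?b \<one>))"
      unfolding R1_def R2_def
      by (rule tangent_map_has_derivative[OF le le differentiable_right_mult]; simp add: points gt)+
    then have J: "(chart_rep ?b ?d j has_derivative (\<lambda>u. (R1 u, R2 u))) (at (snd ?b \<one>))"
      unfolding j_def using gt by (intro chart_rep_pair) simp_all
    have "continuous_map (mfd_topology MG) (mfd_topology ?P) j"
      using differentiable_map_pair[OF differentiable_right_mult[OF gt(1)] differentiable_right_mult[OF gt(2)]]
      by (simp add: differentiable_map_def j_def)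
    \<comment> \<open>the derivative of \<open>F \<circ> j\<close>, to be compared with that of a constant\<close>
    from has_derivative_chart_rep_compose[OF locally_euclidean_chart[OF le b(1)] b(2)
        locally_euclidean_chart[OF leP d(1)] _ this J, of e F L]
    have FJ: "(chart_rep ?b e (F \<circ> j) has_derivative (L \<circ> (\<lambda>u. (R1 u, R2 u)))) (at (snd ?b \<one>))"
      using L d(2) gt by (simp add: j_def)
    have const: "(F \<circ> j) x = inv (g1 t) \<otimes> g2 t" if "x \<in> carrier G" for x
    proof -
      have "inv (x \<otimes> g1 t) \<otimes> (x \<otimes> g2 t) = inv (g1 t) \<otimes> (inv x \<otimes> (x \<otimes> g2 t))"
        using that gt by (simp add: inv_mult_group m_assoc)
      then show ?thesis using that gt by (simp add: F_def j_def m_assoc[symmetric])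
    qed
    obtain Q where Q: "open Q" "snd ?b \<one> \<in> Q"
      "\<And>u. u \<in> Q \<Longrightarrow> inv_into (fst ?b) (snd ?b) u \<in> fst ?b"
      using chart_inverse_neighbourhood[OF locally_euclidean_chart[OF le b(1)] b(2)
         continuous_map_id topological_chartD(1)[OF locally_euclidean_chart[OF le b(1)]]] b(2)
      by (metis id_apply)
    have sub: "fst ?b \<subseteq> carrier G"
      using openin_subset[OF topological_chartD(1)[OF locally_euclidean_chart[OF le b(1)]]] points by simp
    have "((\<lambda>u. snd e (inv (g1 t) \<otimes> g2 t)) has_derivative (L \<circ> (\<lambda>u. (R1 u, R2 u)))) (at (snd ?b \<one>))"
    proof (rule has_derivative_transform_within_open[OF FJ Q(1,2)])
      fix u assume "u \<in> Q"
      then have "inv_into (fst ?b) (snd ?b) u \<in> carrier G" using Q(3) sub by blast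
      from const[OF this]
      show "chart_rep ?b e (F \<circ> j) u = snd e (inv (g1 t) \<otimes> g2 t)" by (simp add: chart_rep_def)
    qed
    then have "L \<circ> (\<lambda>u. (R1 u, R2 u)) = (\<lambda>u. 0)"
      using has_derivative_const has_derivative_unique by blast
    then show ?thesis by (metis comp_apply v)
  qed
  ultimately show ?thesis by (simp add: F_def o_def)
qed

lemma evolution_unique:
  assumes g1: "is_evolution G MG q g1" and g2: "is_evolution G MG q g2" and t: "t \<in> {0..1}"
  shows "g1 t = g2 t"
proof -
  let ?h = "\<lambda>t. inv (g1 t) \<otimes> g2 t"
  have "?h t = ?h 0"
  proof (rule curve_constant_if_velocity_zero[OF locally_euclidean _ _ t])
    have F: "differentiable_map (prod_manifold MG MG) MG (\<lambda>p. inv (fst p) \<otimes> snd p)"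
      using locally_euclidean_prod locally_euclidean smooth_manifold
      by (intro differentiable_mult differentiable_inv differentiable_map_fst differentiable_map_snd)
    have "continuous_map (top_of_set {0..1}) (mfd_topology (prod_manifold MG MG)) (\<lambda>s. (g1 s, g2 s))"
      using g1 g2 by (simp add: is_evolution_def prod_manifold_def smooth_curve_def continuous_map_paired)
    moreover have "continuous_map (mfd_topology (prod_manifold MG MG)) (mfd_topology MG)
        (\<lambda>p. inv (fst p) \<otimes> snd p)"
      using F unfolding differentiable_map_def by (rule conjunct1)
    ultimately have "continuous_map (top_of_set {0..1}) (mfd_topology MG)
        ((\<lambda>p. inv (fst p) \<otimes> snd p) \<circ> (\<lambda>s. (g1 s, g2 s)))"
      by (rule continuous_map_compose)
    then show "continuous_map (top_of_set {0..1}) (mfd_topology MG) ?h"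
      by (simp add: o_def)
  qed (use evolution_quotient_velocity_zero[OF g1 g2] in blast)
  also have "?h 0 = \<one>" using g1 g2 by (simp add: is_evolution_def)
  finally have "inv (g1 t) \<otimes> g2 t = \<one>" .
  then show ?thesis
    using evolution_carrier[OF g1 t] evolution_carrier[OF g2 t]
    by (metis inv_closed inv_equality inv_inv)
qed

lemma evolution_reparametrise:
  assumes g: "is_evolution G MG q g" and \<phi>: "\<phi> \<in> Diff_plus"
    and r: "\<And>t. t \<in> {0..1} \<Longrightarrow> r t = vector_derivative \<phi> (at t within {0..1}) *\<^sub>R q (\<phi> t)"
  shows "is_evolution G MG r (g \<circ> \<phi>)"
  unfolding is_evolution_def
proof (intro conjI ballI)
  have sm: "smooth_curve MG g" using g by (simp add: is_evolution_def)
  show "smooth_curve MG (g \<circ> \<phi>)" by (rule smooth_curve_reparametrise[OF locally_euclidean sm \<phi>])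
  show "(g \<circ> \<phi>) 0 = \<one>" using g Diff_plus_0[OF \<phi>] by (simp add: is_evolution_def)
  fix t :: real assume t: "t \<in> {0..1}"
  have pt: "\<phi> t \<in> {0..1}" by (rule Diff_plus_maps_to[OF \<phi> t])
  have "velocity MG (g \<circ> \<phi>) t = vector_derivative \<phi> (at t within {0..1}) *\<^sub>R
      tangent_map MG MG (\<lambda>x. x \<otimes> g (\<phi> t)) \<one> (q (\<phi> t))"
    using velocity_reparametrise[OF locally_euclidean sm \<phi> t] g pt by (simp add: is_evolution_def)
  also have "\<dots> = tangent_map MG MG (\<lambda>x. x \<otimes> g (\<phi> t)) \<one> (r t)"
    using linear_cmul[OF linear_tangent_right_mult[OF evolution_carrier[OF g pt]]] r[OF t] by simp
  finally show "velocity MG (g \<circ> \<phi>) t = tangent_map MG MG (\<lambda>x. x \<otimes> (g \<circ> \<phi>) t) \<one> (r t)"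
    by simp
qed

lemma Evol_is_evolution: "is_evolution G MG q g \<Longrightarrow> is_evolution G MG q (Evol G MG q)"
  unfolding Evol_def by (metis someI)

lemma Evol_carrier: "t \<in> {0..1} \<Longrightarrow> Evol G MG q t \<in> carrier G"
  using Evol_is_evolution evolution_carrier by (metis Evol_def one_closed)

text \<open>The substitution \<open>g \<mapsto> g \<circ> \<phi>\<close> and its inverse \<open>g \<mapsto> g \<circ> inv_into {0..1} \<phi>\<close> exchange the solutions for \<open>q\<close> and for
  \<open>r\<close>. So either both problems are solvable and uniqueness gives the equation, or neither is and both
  sides are the default value.\<close>

lemma Evol_reparametrise:
  assumes \<phi>: "\<phi> \<in> Diff_plus"
    and r: "\<And>t. t \<in> {0..1} \<Longrightarrow> r t = vector_derivative \<phi> (at t within {0..1}) *\<^sub>R q (\<phi> t)"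
    and t: "t \<in> {0..1}"
  shows "Evol G MG r t = Evol G MG q (\<phi> t)"
proof (cases "\<exists>g. is_evolution G MG q g")
  case True
  then have "is_evolution G MG r (Evol G MG q \<circ> \<phi>)"
    using evolution_reparametrise[OF Evol_is_evolution \<phi> r] by blast
  then show ?thesis
    using evolution_unique[OF Evol_is_evolution _ t] by fastforce
next
  case False
  let ?\<psi> = "inv_into {0..1} \<phi>"
  note inv = Diff_plus_inverse[OF \<phi>]
  have q: "q t = vector_derivative ?\<psi> (at t within {0..1}) *\<^sub>R r (?\<psi> t)" if "t \<in> {0..1}" for t
    using r[OF Diff_plus_maps_to[OF inv(1) that]] inv(2,3)[OF that] by simp
  have "\<nexists>g. is_evolution G MG r g"
    using evolution_reparametrise[OF _ inv(1) q] False by blast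
  then show ?thesis using False by (simp add: Evol_def)
qed

end

section \<open>Submersions and the projection onto the homogeneous space\<close>

text \<open>The local normal form of a submersion. With a linear right inverse \<open>S\<close> of \<open>A\<close>, the map
  \<open>\<Phi> x = S (P x) + (x - x0) - S (A (x - x0))\<close> has derivative the identity at \<open>x0\<close> and satisfies
  \<open>A (\<Phi> x) = P x\<close>; its local inverse \<open>\<Psi>\<close> straightens \<open>P\<close> to the linear map \<open>A\<close>. Then \<open>\<Psi> \<circ> S\<close> is a
  local section of \<open>P\<close>, and \<open>\<Psi>\<close> maps translates of the kernel of \<open>A\<close> into fibres of \<open>P\<close>.\<close>

lemma submersion_local_inverse:
  fixes P :: "'a::euclidean_space \<Rightarrow> 'b::euclidean_space"
  assumes U: "open U" "x0 \<in> U" and P: "smooth_on U P"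
    and A: "(P has_derivative A) (at x0)" and surj: "surj A"
  obtains S \<Psi> W where "linear S" "\<And>z. A (S z) = z" "open W" "S (P x0) \<in> W" "\<Psi> (S (P x0)) = x0"
    "(\<Psi> has_derivative (\<lambda>v. v)) (at (S (P x0)))"
    "\<And>y. y \<in> W \<Longrightarrow> \<Psi> y \<in> U" "\<And>y. y \<in> W \<Longrightarrow> P (\<Psi> y) = A y"
proof -
  have linA: "linear A" using A by (rule has_derivative_linear)
  obtain S where S: "linear S" "A \<circ> S = id"
    using linear_surjective_right_inverse[OF linA surj] by blast
  then have AS: "A (S z) = z" for z by (metis comp_apply id_apply)
  define D where "D x = frechet_derivative P (at x)" for x
  have Ck: "Ck_on (Suc 0) U P" using P unfolding smooth_on_def by blast
  have at: "at x within U = at x" if "x \<in> U" for x using U(1) that by (rule at_within_open[rotated])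
  have D: "(P has_derivative D x) (at x)" if "x \<in> U" for x
    using Ck_on_has_derivative[OF Ck that] at[OF that] by (simp add: D_def)
  have Dcont: "continuous_on U (\<lambda>x. D x v)" for v
  proof -
    have "continuous_on U (\<lambda>x. frechet_derivative P (at x within U) v)" using Ck by simp
    then show ?thesis
      by (rule continuous_on_eq) (simp add: at D_def)
  qed
  \<comment> \<open>so that \<open>\<Phi>\<close> below has derivative \<open>id\<close> at \<open>x0\<close>\<close>
  have DA: "D x0 = A" using D[OF U(2)] A has_derivative_unique by blast
  define \<Phi> where "\<Phi> x = S (P x) + (x - x0) - S (A (x - x0))" for x
  define \<Phi>' where "\<Phi>' x = Blinfun (\<lambda>v. S (D x v) + v - S (A v))" for x
  note bl = linear_conv_bounded_linear[THEN iffD1]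
  have \<Phi>'_apply: "blinfun_apply (\<Phi>' x) = (\<lambda>v. S (D x v) + v - S (A v))" if "x \<in> U" for x
  proof -
    have "linear (\<lambda>v. S (D x v))" "linear (\<lambda>v. S (A v))"
      using linear_compose[OF has_derivative_linear[OF D[OF that]] S(1)] linear_compose[OF linA S(1)]
      by (simp_all add: o_def)
    then have "bounded_linear (\<lambda>v. S (D x v) + v - S (A v))"
      by (intro bounded_linear_sub bounded_linear_add bounded_linear_ident bl)
    then show ?thesis unfolding \<Phi>'_def by (rule bounded_linear_Blinfun_apply)
  qed
  have S_der: "(S has_derivative S) (at z within X)" and A_der: "(A has_derivative A) (at z' within X')" for z X z' X'
    using S(1) linA by (auto intro: bounded_linear_imp_has_derivative bl)
  obtain U' V g g' where inv: "open U'" "U' \<subseteq> U" "x0 \<in> U'" "open V" "\<Phi> x0 \<in> V"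
     "homeomorphism U' V \<Phi> g" "\<And>y. y \<in> V \<Longrightarrow> (g has_derivative (g' y)) (at y)"
     "\<And>y. y \<in> V \<Longrightarrow> g' y = inv_into UNIV (blinfun_apply (\<Phi>' (g y)))"
  proof (rule inverse_function_theorem[of U \<Phi> \<Phi>' x0 id_blinfun])
    fix x assume x: "x \<in> U"
    have "((\<lambda>x. S (P x)) has_derivative (\<lambda>v. S (D x v))) (at x)"
      by (rule has_derivative_compose[OF D[OF x] S_der])
    moreover have "((\<lambda>x. A (x - x0)) has_derivative (\<lambda>v. A v)) (at x)"
      by (rule has_derivative_compose[OF _ A_der]) (auto intro!: derivative_eq_intros)
    then have "((\<lambda>x. S (A (x - x0))) has_derivative (\<lambda>v. S (A v))) (at x)"
      by (rule has_derivative_compose[OF _ S_der])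
    moreover have "((\<lambda>x. x - x0) has_derivative (\<lambda>v. v)) (at x)"
      by (auto intro!: derivative_eq_intros)
    ultimately have "(\<Phi> has_derivative (\<lambda>v. S (D x v) + v - S (A v))) (at x)"
      unfolding \<Phi>_def by (intro has_derivative_add has_derivative_diff)
    then show "(\<Phi> has_derivative blinfun_apply (\<Phi>' x)) (at x)"
      using \<Phi>'_apply[OF x] by simp
  next
    show "continuous_on U \<Phi>'"
    proof (rule continuous_on_blinfun_componentwise)
      fix i :: 'a
      have "continuous_on U (\<lambda>x. S (D x i) + i - S (A i))"
        by (intro continuous_intros bounded_linear.continuous_on[OF bl[OF S(1)]] Dcont)
      then show "continuous_on U (\<lambda>x. blinfun_apply (\<Phi>' x) i)"
        by (rule continuous_on_eq) (simp add: \<Phi>'_apply)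
    qed
    show "id_blinfun o\<^sub>L \<Phi>' x0 = id_blinfun"
      by (rule blinfun_eqI) (simp add: \<Phi>'_apply[OF U(2)] DA)
  qed (use U in auto)
  have \<Phi>x0: "\<Phi> x0 = S (P x0)"
    using linear_0[OF S(1)] linear_0[OF linA] by (simp add: \<Phi>_def)
  have gx0: "g (S (P x0)) = x0" using inv(3,6) by (simp add: homeomorphism_def flip: \<Phi>x0)
  show thesis
  proof
    show "linear S" "\<And>z. A (S z) = z" "open V" "S (P x0) \<in> V" "g (S (P x0)) = x0"
      using S(1) AS inv(4,5) gx0 by (simp_all add: \<Phi>x0)
    have "blinfun_apply (\<Phi>' x0) = id" using \<Phi>'_apply[OF U(2)] by (auto simp: DA)
    then have "g' (S (P x0)) = id"
      using inv(8)[OF inv(5)] by (simp add: \<Phi>x0 gx0)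
    then show "(g has_derivative (\<lambda>v. v)) (at (S (P x0)))"
      using inv(7)[OF inv(5)] by (simp add: \<Phi>x0 id_def)
    fix y assume y: "y \<in> V"
    then have gy: "g y \<in> U'" "\<Phi> (g y) = y" using inv(6) by (auto simp: homeomorphism_def)
    show "g y \<in> U" using gy(1) inv(2) by blast
    have "A (\<Phi> x) = P x" for x
      using AS by (simp add: \<Phi>_def linear_add[OF linA] linear_diff[OF linA])
    then show "P (g y) = A y" using gy(2) by metis
  qed
qed

lemma continuous_map_inv_chart:
  assumes "topological_chart X c"
  shows "continuous_map (top_of_set (snd c ` fst c)) X (inv_into (fst c) (snd c))"
proof -
  note D = topological_chartD[OF assms]
  have "openin (top_of_set (snd c ` fst c)) {u \<in> snd c ` fst c. inv_into (fst c) (snd c) u \<in> W}"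
    if W: "openin X W" for W
  proof -
    have "{u \<in> snd c ` fst c. inv_into (fst c) (snd c) u \<in> W} = snd c ` (fst c \<inter> W)"
      using assms by auto
    then show ?thesis using D(3)[OF W] by (auto intro: open_subset)
  qed
  then show ?thesis
    using openin_subset[OF D(1)] assms by (auto simp: continuous_map_def)
qed

locale homogeneous_manifold = lie_group_manifold G MG
  for G :: "'g monoid" (structure) and MG :: "('g, 'e::euclidean_space) manifold" +
  fixes H :: "'g set" and M :: "('g set, 'f::euclidean_space) manifold"
  assumes homogeneous_space: "homogeneous_space G MG H M"
begin

abbreviation "\<pi> \<equiv> coset_proj G H"

lemma locally_euclidean_quotient: "locally_euclidean M"
  using homogeneous_space by (simp add: homogeneous_space_def smooth_manifold_imp_locally_euclidean)

lemma subgroup_H: "subgroup H G"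
  using homogeneous_space by (simp add: homogeneous_space_def closed_lie_subgroup_def)

lemma smooth_proj: "smooth_map MG M \<pi>"
  and surj_tangent_proj: "x \<in> carrier G \<Longrightarrow> surj (tangent_map MG M \<pi> x)"
  using homogeneous_space points by (simp_all add: homogeneous_space_def submersion_def)

lemma differentiable_proj: "differentiable_map MG M \<pi>"
  by (rule smooth_map_imp_differentiable_map[OF locally_euclidean locally_euclidean_quotient smooth_proj])

lemma points_quotient: "points M = \<pi> ` carrier G"
  using homogeneous_space by (auto simp: homogeneous_space_def LCOSETS_def coset_proj_def)

lemma proj_one_eq_iff:
  assumes "x \<in> carrier G"
  shows "\<pi> x = \<pi> \<one> \<longleftrightarrow> x \<in> H"
proof -
  have "\<pi> \<one> = H" using lcos_mult_one[OF subgroup.subset[OF subgroup_H]] by (simp add: coset_proj_def)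
  then show ?thesis
    using lcos_self[OF assms subgroup_H] coset_join3[OF assms subgroup_H]
    unfolding coset_proj_def by metis
qed

lemma action_proj: "a \<in> carrier G \<Longrightarrow> x \<in> carrier G \<Longrightarrow> coset_action G a (\<pi> x) = \<pi> (a \<otimes> x)"
  using subgroup.subset[OF subgroup_H] by (simp add: coset_action_def coset_proj_def lcos_m_assoc)

lemma proj_local_inverse:
  assumes x0: "x0 \<in> carrier G"
  defines "b \<equiv> chart_at MG x0" and "d \<equiv> chart_at M (\<pi> x0)" and "A \<equiv> tangent_map MG M \<pi> x0"
  obtains S \<Psi> W where "linear S" "\<And>z. A (S z) = z" "open W" "S (snd d (\<pi> x0)) \<in> W"
    "\<Psi> (S (snd d (\<pi> x0))) = snd b x0"
    "(\<Psi> has_derivative (\<lambda>v. v)) (at (S (snd d (\<pi> x0))))"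
    "\<And>y. y \<in> W \<Longrightarrow> \<exists>x\<in>fst b. \<Psi> y = snd b x \<and> \<pi> x \<in> fst d \<and> snd d (\<pi> x) = A y"
proof -
  have px: "\<pi> x0 \<in> points M" using x0 by (simp add: points_quotient)
  have b: "b \<in> mfd_atlas MG" "x0 \<in> fst b" and d: "d \<in> mfd_atlas M" "\<pi> x0 \<in> fst d"
    unfolding b_def d_def using chart_at[OF locally_euclidean] chart_at[OF locally_euclidean_quotient px] x0
    by (simp_all add: points)
  note tb = locally_euclidean_chart[OF locally_euclidean b(1)]
  let ?U = "snd b ` (fst b \<inter> \<pi> -` fst d)" and ?P = "chart_rep b d \<pi>"
  have op: "open ?U"
    using smooth_map_domain[OF locally_euclidean locally_euclidean_quotient _ b(1) d(1)] smooth_proj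
    by (simp add: smooth_map_def)
  have sm: "smooth_on ?U ?P"
    using smooth_proj b(1) d(1) unfolding smooth_map_def chart_rep_def by fastforce
  have A: "(?P has_derivative A) (at (snd b x0))"
    unfolding A_def b_def d_def
    using tangent_map_has_derivative[OF locally_euclidean locally_euclidean_quotient differentiable_proj] x0
    by (simp add: points)
  have xU: "snd b x0 \<in> ?U" using b(2) d(2) by blast
  have P0: "?P (snd b x0) = snd d (\<pi> x0)" using tb b(2) by (simp add: chart_rep_def)
  obtain S \<Psi> W where *: "linear S" "\<And>z. A (S z) = z" "open W" "S (?P (snd b x0)) \<in> W"
    "\<Psi> (S (?P (snd b x0))) = snd b x0" "(\<Psi> has_derivative (\<lambda>v. v)) (at (S (?P (snd b x0))))"
    "\<And>y. y \<in> W \<Longrightarrow> \<Psi> y \<in> ?U" "\<And>y. y \<in> W \<Longrightarrow> ?P (\<Psi> y) = A y"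
    by (rule submersion_local_inverse[OF op xU sm A surj_tangent_proj[OF x0, folded A_def]])
       (rule that; assumption)
  have "\<exists>x\<in>fst b. \<Psi> y = snd b x \<and> \<pi> x \<in> fst d \<and> snd d (\<pi> x) = A y" if y: "y \<in> W" for y
  proof -
    obtain x where x: "x \<in> fst b" "\<pi> x \<in> fst d" "\<Psi> y = snd b x" using *(7)[OF y] by auto
    moreover have "snd d (\<pi> x) = A y"
      using *(8)[OF y] x(1,3) tb by (simp add: chart_rep_def)
    ultimately show ?thesis by blast
  qed
  then show thesis by (rule that[OF *(1-3) *(4-6)[unfolded P0]])
qed

text \<open>The action of \<open>a\<close> on the quotient lifts to left multiplication. Composing the differentiable map
  \<open>\<pi> \<circ> (\<lambda>x. a \<otimes> x)\<close> with a local section of the projection shows that the action is differentiable.\<close>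

lemma action_tangent_linear:
  assumes a: "a \<in> carrier G" and p: "p \<in> points M"
  shows "linear (tangent_map M M (coset_action G a) p)"
proof -
  obtain x0 where x0: "x0 \<in> carrier G" "p = \<pi> x0" using p points_quotient by blast
  let ?b = "chart_at MG x0" and ?d = "chart_at M p" and ?e = "chart_at M (coset_action G a p)"
  have act: "coset_action G a p = \<pi> (a \<otimes> x0)" using a x0 action_proj by simp
  then have "coset_action G a p \<in> points M" using a x0 by (simp add: points_quotient)
  note e = chart_at[OF locally_euclidean_quotient this]
  have b: "?b \<in> mfd_atlas MG" "x0 \<in> fst ?b" using chart_at[OF locally_euclidean] x0 by (simp_all add: points)
  have d: "?d \<in> mfd_atlas M" "p \<in> fst ?d" using chart_at[OF locally_euclidean_quotient p] .
  note tb = locally_euclidean_chart[OF locally_euclidean b(1)]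
   and td = locally_euclidean_chart[OF locally_euclidean_quotient d(1)]
  have subb: "fst ?b \<subseteq> carrier G" using openin_subset[OF topological_chartD(1)[OF tb]] points by simp
  obtain S W \<Psi> where *: "linear S" "\<And>z. tangent_map MG M \<pi> x0 (S z) = z" "open W" "S (snd ?d p) \<in> W"
    "\<Psi> (S (snd ?d p)) = snd ?b x0" "(\<Psi> has_derivative (\<lambda>v. v)) (at (S (snd ?d p)))"
    "\<And>y. y \<in> W \<Longrightarrow> \<exists>x\<in>fst ?b. \<Psi> y = snd ?b x \<and> \<pi> x \<in> fst ?d \<and> snd ?d (\<pi> x) = tangent_map MG M \<pi> x0 y"
    by (rule proj_local_inverse[OF x0(1), folded x0(2)]) (rule that; assumption)
  have "differentiable_map MG M (\<pi> \<circ> (\<lambda>x. a \<otimes> x))"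
    by (rule differentiable_map_compose[OF locally_euclidean locally_euclidean differentiable_left_mult[OF a] differentiable_proj])
  moreover have "(\<pi> \<circ> (\<lambda>x. a \<otimes> x)) x0 \<in> fst ?e" using e(2) act by simp
  ultimately obtain K where K: "(chart_rep ?b ?e (\<pi> \<circ> (\<lambda>x. a \<otimes> x)) has_derivative K) (at (snd ?b x0))"
    using differentiable_mapD[OF _ b(1) e(1) b(2)] by blast
  have blS: "bounded_linear S" using *(1) by (simp add: linear_conv_bounded_linear)
  have "(S has_derivative S) (at (snd ?d p))" by (rule bounded_linear_imp_has_derivative[OF blS])
  from has_derivative_compose[OF this *(6)]
  have "((\<lambda>z. \<Psi> (S z)) has_derivative S) (at (snd ?d p))" .
  from has_derivative_compose[OF this, of "chart_rep ?b ?e (\<pi> \<circ> (\<lambda>x. a \<otimes> x))" K] K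
  have "((\<lambda>z. chart_rep ?b ?e (\<pi> \<circ> (\<lambda>x. a \<otimes> x)) (\<Psi> (S z))) has_derivative (\<lambda>v. K (S v))) (at (snd ?d p))"
    by (simp add: *(5))
  then have "(chart_rep ?d ?e (coset_action G a) has_derivative (\<lambda>v. K (S v))) (at (snd ?d p))"
  proof (rule has_derivative_transform_within_open)
    have "continuous_on UNIV S" by (rule linear_continuous_on[OF blS])
    then show "open (S -` W)" using *(3) by (simp add: open_vimage)
    show "snd ?d p \<in> S -` W" using *(4) by simp
    fix z assume "z \<in> S -` W"
    then obtain x where x: "x \<in> fst ?b" "\<Psi> (S z) = snd ?b x" "\<pi> x \<in> fst ?d" "snd ?d (\<pi> x) = z"
      using *(7)[of "S z"] *(2) by (metis vimageE)
    have "inv_into (fst ?d) (snd ?d) z = \<pi> x" using inv_into_chart[OF td x(3)] x(4) by simp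
    moreover have "x \<in> carrier G" using x(1) subb by blast
    ultimately show "chart_rep ?b ?e (\<pi> \<circ> (\<lambda>x. a \<otimes> x)) (\<Psi> (S z)) = chart_rep ?d ?e (coset_action G a) z"
      using x(1,2) tb a by (simp add: chart_rep_def action_proj)
  qed
  then have "chart_rep ?d ?e (coset_action G a) differentiable (at (snd ?d p))"
    by (auto simp: differentiable_def)
  then show ?thesis unfolding tangent_map_eq_chart_rep
    by (rule linear_frechet_derivative)
qed

text \<open>The projection is constant along curves in \<open>H\<close>.\<close>

lemma tangent_proj_lie_algebra:
  assumes "X \<in> lie_algebra_of G MG H"
  shows "tangent_map MG M \<pi> \<one> X = 0"
proof -
  obtain c where X: "X = velocity MG c 0" and c: "smooth_curve MG c" "c ` {0..1} \<subseteq> H" "c 0 = \<one>"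
    using assms by (auto simp: lie_algebra_of_def)
  let ?b = "chart_at MG \<one>" and ?d = "chart_at M (\<pi> \<one>)"
  have b: "?b \<in> mfd_atlas MG" "\<one> \<in> fst ?b" using chart_at[OF locally_euclidean] by (simp_all add: points)
  have v: "((snd ?b \<circ> c) has_vector_derivative X) (at 0 within {0..1})"
    using velocity_has_vector_derivative[OF locally_euclidean c(1), of 0] c(3) X by simp
  have A: "(chart_rep ?b ?d \<pi> has_derivative tangent_map MG M \<pi> \<one>) (at (snd ?b (c 0)))"
    using tangent_map_has_derivative[OF locally_euclidean locally_euclidean_quotient differentiable_proj, of \<one>]
    by (simp add: points c(3))
  have cont: "continuous_map (top_of_set {0..1}) (mfd_topology MG) c"
    using c(1) by (simp add: smooth_curve_def)
  have cb: "c 0 \<in> fst ?b" using b(2) c(3) by simp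
  have 1: "((snd ?d \<circ> (\<pi> \<circ> c)) has_vector_derivative tangent_map MG M \<pi> \<one> X) (at 0 within {0..1})"
    by (rule has_vector_derivative_chart_rep_compose[OF locally_euclidean_chart[OF locally_euclidean b(1)] cb cont _ v A]) simp
  have 2: "((snd ?d \<circ> (\<pi> \<circ> c)) has_vector_derivative 0) (at 0 within {0..1})"
  proof (rule has_vector_derivative_transform)
    show "((\<lambda>t. snd ?d (\<pi> \<one>)) has_vector_derivative 0) (at 0 within {0..1::real})"
      by (rule has_vector_derivative_const)
    fix t :: real assume "t \<in> {0..1}"
    then have "c t \<in> H" using c(2) by blast
    then have "\<pi> (c t) = \<pi> \<one>"
      using proj_one_eq_iff subgroup.mem_carrier[OF subgroup_H] by blast
    then show "(snd ?d \<circ> (\<pi> \<circ> c)) t = snd ?d (\<pi> \<one>)" by simp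
  qed simp
  have "at 0 within {0..1::real} \<noteq> bot"
    by (simp add: trivial_limit_within)
  from vector_derivative_unique_within[OF this 1 2] show ?thesis .
qed

end

section \<open>The kernel of the tangent map of the projection\<close>

text \<open>A vector orthogonal to \<open>L\<close> is orthogonal to the curve near \<open>0\<close>, hence to its derivative.\<close>

lemma subspace_contains_derivative:
  fixes w :: "real \<Rightarrow> 'a::euclidean_space"
  assumes L: "subspace L" and w: "(w has_vector_derivative v) (at 0)"
    and \<epsilon>: "\<epsilon> > 0" "\<And>s. \<bar>s\<bar> < \<epsilon> \<Longrightarrow> w s \<in> L"
  shows "v \<in> L"
proof -
  have "n \<bullet> v = 0" if n: "\<And>y. y \<in> L \<Longrightarrow> y \<bullet> n = 0" for n
  proof -
    have "((\<lambda>s. n \<bullet> w s) has_vector_derivative n \<bullet> v) (at 0)"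
      using w by (rule bounded_linear.has_vector_derivative[OF bounded_linear_inner_right])
    moreover have "((\<lambda>s. n \<bullet> w s) has_vector_derivative 0) (at 0)"
    proof (rule has_vector_derivative_transform_within[OF _ \<epsilon>(1)])
      show "((\<lambda>s. 0) has_vector_derivative 0) (at (0::real))" by (rule has_vector_derivative_const)
      show "0 = n \<bullet> w s" if "dist s 0 < \<epsilon>" for s
        using n[OF \<epsilon>(2), of s] that by (simp add: inner_commute)
    qed simp
    ultimately show ?thesis by (rule vector_derivative_unique_at)
  qed
  then have "v \<in> L\<^sup>\<bottom>\<^sup>\<bottom>"
    by (simp add: orthogonal_comp_def orthogonal_def)
  then show ?thesis using orthogonal_comp_self[OF L] by simp
qed

lemma smooth_curve_in_chart:
  assumes M: "locally_euclidean M" and k: "compatible_chart M k"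
    and line: "\<And>t. t \<in> {0..1} \<Longrightarrow> u + t *\<^sub>R X \<in> snd k ` fst k"
  shows "smooth_curve M (\<lambda>t. inv_into (fst k) (snd k) (u + t *\<^sub>R X))"
proof -
  let ?c = "\<lambda>t. inv_into (fst k) (snd k) (u + t *\<^sub>R X)"
  have tk: "topological_chart (mfd_topology M) k" using k by (simp add: compatible_chart_def)
  have "continuous_map (top_of_set {0..1}) (top_of_set (snd k ` fst k)) (\<lambda>t. u + t *\<^sub>R X)"
    using line by (auto simp: continuous_map_in_subtopology intro!: continuous_intros)
  from continuous_map_compose[OF this continuous_map_inv_chart[OF tk]]
  have cont: "continuous_map (top_of_set {0..1}) (mfd_topology M) ?c" by (simp add: o_def)
  have "smooth_on ({0..1} \<inter> ?c -` fst d) (snd d \<circ> ?c)" if d: "d \<in> mfd_atlas M" for d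
  proof -
    let ?T = "{0..1} \<inter> ?c -` fst d"
    have "openin (top_of_set {0..1}) {t \<in> topspace (top_of_set {0..1}). ?c t \<in> fst d}"
      using topological_chartD(1)[OF locally_euclidean_chart[OF M d]]
      by (rule openin_continuous_map_preimage[OF cont])
    moreover have "{t \<in> topspace (top_of_set {0..1}). ?c t \<in> fst d} = ?T" by auto
    ultimately have T: "openin (top_of_set {0..1}) ?T" by simp
    have sm: "smooth_on (snd k ` (fst k \<inter> fst d)) (snd d \<circ> inv_into (fst k) (snd k))"
      using k d by (auto simp: compatible_chart_def smooth_transition_def case_prod_beta)
    have sub: "(\<lambda>t. u + t *\<^sub>R X) ` ?T \<subseteq> snd k ` (fst k \<inter> fst d)"
    proof
      fix y assume "y \<in> (\<lambda>t. u + t *\<^sub>R X) ` ?T"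
      then obtain t where t: "t \<in> {0..1}" "?c t \<in> fst d" "y = u + t *\<^sub>R X" by blast
      obtain x where x: "x \<in> fst k" "y = snd k x" using line[OF t(1)] t(3) by blast
      then have "x \<in> fst d" using t(2) tk by (simp flip: t(3))
      then show "y \<in> snd k ` (fst k \<inter> fst d)" using x by blast
    qed
    have "Ck_on n ?T (\<lambda>t. (snd d \<circ> inv_into (fst k) (snd k)) (u + t *\<^sub>R X))" for n
      using sm unfolding smooth_on_def by (intro Ck_on_compose_line[OF T _ sub]) blast
    then show ?thesis by (simp add: smooth_on_def o_def)
  qed
  then show ?thesis using cont by (auto simp: smooth_curve_def)
qed

text \<open>The composite of the two transitions is the identity near the point, hence so is that of their
  derivatives.\<close>

lemma compatible_chart_transitions:
  assumes M: "locally_euclidean M" and k: "compatible_chart M k" "p \<in> fst k"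
    and b: "b \<in> mfd_atlas M" "p \<in> fst b"
  obtains T T' where "(chart_rep b k (\<lambda>x. x) has_derivative T) (at (snd b p))"
    "(chart_rep k b (\<lambda>x. x) has_derivative T') (at (snd k p))" "\<And>v. T' (T v) = v"
proof -
  have tk: "topological_chart (mfd_topology M) k" using k by (simp add: compatible_chart_def)
  note tb = locally_euclidean_chart[OF M b(1)]
  have "open (snd b ` (fst b \<inter> fst k))" "open (snd k ` (fst k \<inter> fst b))"
    using topological_chartD(1,3) tb tk by blast+
  moreover have "smooth_on (snd b ` (fst b \<inter> fst k)) (chart_rep b k (\<lambda>x. x))"
     "smooth_on (snd k ` (fst k \<inter> fst b)) (chart_rep k b (\<lambda>x. x))"
    using k b by (auto simp: compatible_chart_def smooth_transition_def case_prod_beta chart_rep_def o_def)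
  ultimately have "chart_rep b k (\<lambda>x. x) differentiable (at (snd b p))"
    "chart_rep k b (\<lambda>x. x) differentiable (at (snd k p))"
    using k(2) b(2) smooth_on_open_imp_differentiable by blast+
  then obtain T T' where T: "(chart_rep b k (\<lambda>x. x) has_derivative T) (at (snd b p))"
    and T': "(chart_rep k b (\<lambda>x. x) has_derivative T') (at (snd k p))"
    by (auto simp: differentiable_def)
  have cont: "continuous_map (mfd_topology M) (mfd_topology M) (\<lambda>x. x)" by simp
  have TT: "(chart_rep b b ((\<lambda>x. x) \<circ> (\<lambda>x. x)) has_derivative T' \<circ> T) (at (snd b p))"
    by (rule has_derivative_chart_rep_compose[OF tb b(2) tk k(2) cont T T'])
  obtain Q where Q: "open Q" "snd b p \<in> Q"
    "\<And>u. u \<in> Q \<Longrightarrow> snd b (inv_into (fst b) (snd b) u) = u"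
    using chart_inverse_neighbourhood[OF tb b(2) cont topological_chartD(1)[OF tb] b(2)] by metis
  have "((\<lambda>u. u) has_derivative T' \<circ> T) (at (snd b p))"
    by (rule has_derivative_transform_within_open[OF TT Q(1,2)]) (simp add: chart_rep_def Q(3))
  then have "T' \<circ> T = (\<lambda>v. v)" using has_derivative_unique has_derivative_ident by blast
  then have "T' (T v) = v" for v by (metis comp_apply)
  then show thesis using that T T' by blast
qed

context homogeneous_manifold
begin

text \<open>The local inverse \<open>\<Psi>\<close> carries a line in direction \<open>Z\<close> into the fibre of the projection over the base
  point, which is \<open>H\<close>, and the image has derivative \<open>Z\<close>. In a chart that flattens \<open>H\<close> to a linear subspace \<open>L\<close>, this
  puts the coordinate vector \<open>T Z\<close> of \<open>Z\<close> into \<open>L\<close>. A segment in direction \<open>T Z\<close> is then a smooth curve in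
  \<open>H\<close>, shortened by the factor \<open>\<epsilon>\<close> so that it stays in the chart for the whole unit interval.\<close>

lemma kernel_proj_lie_algebra:
  assumes Z: "tangent_map MG M \<pi> \<one> Z = 0"
  shows "\<exists>\<epsilon>>0. \<epsilon> *\<^sub>R Z \<in> lie_algebra_of G MG H"
proof -
  let ?b = "chart_at MG \<one>" and ?d = "chart_at M (\<pi> \<one>)"
  have oneH: "\<one> \<in> H" by (rule subgroup.one_closed[OF subgroup_H])
  obtain L U \<xi> where L: "subspace L" and k': "compatible_chart MG (U, \<xi>)" "\<one> \<in> U" "\<xi> ` (U \<inter> H) = \<xi> ` U \<inter> L"
    using homogeneous_space oneH unfolding homogeneous_space_def closed_lie_subgroup_def by blast
  define k where "k = (U, \<xi>)"
  have k: "compatible_chart MG k" "\<one> \<in> fst k" and flat: "snd k ` (fst k \<inter> H) = snd k ` fst k \<inter> L"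
    using k' by (simp_all add: k_def)
  have tk: "topological_chart (mfd_topology MG) k" using k by (simp add: compatible_chart_def)
  note Dk = topological_chartD[OF tk]
  have b: "?b \<in> mfd_atlas MG" "\<one> \<in> fst ?b" using chart_at[OF locally_euclidean] by (simp_all add: points)
  note tb = locally_euclidean_chart[OF locally_euclidean b(1)]
  have "\<pi> \<one> \<in> points M" by (simp add: points_quotient)
  note d = chart_at[OF locally_euclidean_quotient this]
  note td = locally_euclidean_chart[OF locally_euclidean_quotient d(1)]
  obtain T T' where T: "(chart_rep ?b k (\<lambda>x. x) has_derivative T) (at (snd ?b \<one>))"
    and T': "(chart_rep k ?b (\<lambda>x. x) has_derivative T') (at (snd k \<one>))" and T'T: "\<And>v. T' (T v) = v"
    by (rule compatible_chart_transitions[OF locally_euclidean k b]) (rule that; assumption)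
  define A where "A = tangent_map MG M \<pi> \<one>"
  have linA: "linear A" unfolding A_def
    by (rule tangent_map_linear[OF locally_euclidean locally_euclidean_quotient differentiable_proj]) (simp add: points)
  define z0 where "z0 = snd ?d (\<pi> \<one>)"
  obtain S W \<Psi> where S: "linear S" "\<And>z. A (S z) = z" and W: "open W" "S z0 \<in> W"
    and \<Psi>: "\<Psi> (S z0) = snd ?b \<one>" "(\<Psi> has_derivative (\<lambda>v. v)) (at (S z0))"
    "\<And>y. y \<in> W \<Longrightarrow> \<exists>x\<in>fst ?b. \<Psi> y = snd ?b x \<and> \<pi> x \<in> fst ?d \<and> snd ?d (\<pi> x) = A y"
    by (rule proj_local_inverse[OF one_closed, folded A_def z0_def]) (rule that; assumption)
  \<comment> \<open>a line along which \<open>A\<close> is constant, mapped by \<open>\<Psi>\<close> into the fibre\<close>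
  define y where "y s = S z0 + s *\<^sub>R Z" for s :: real
  have Ay: "A (y s) = z0" for s
    using Z S(2) by (simp add: y_def linear_add[OF linA] linear_cmul[OF linA] flip: A_def)
  have y: "(y has_derivative (\<lambda>s. s *\<^sub>R Z)) (at 0)"
    unfolding y_def by (auto intro!: derivative_eq_intros)
  have y0: "y 0 = S z0" by (simp add: y_def)
  have u: "((\<lambda>s. \<Psi> (y s)) has_derivative (\<lambda>s. s *\<^sub>R Z)) (at 0)"
    by (rule has_derivative_compose[OF y]) (simp add: y0 \<Psi>(2))
  have "((\<lambda>s. chart_rep ?b k (\<lambda>x. x) (\<Psi> (y s))) has_derivative (\<lambda>s. T (s *\<^sub>R Z))) (at 0)"
    by (rule has_derivative_compose[OF u]) (simp add: y0 \<Psi>(1) T)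
  then have w: "((\<lambda>s. chart_rep ?b k (\<lambda>x. x) (\<Psi> (y s))) has_vector_derivative T Z) (at 0)"
    using linear_cmul[OF has_derivative_linear[OF T]] by (simp add: has_vector_derivative_def)
  obtain Q where Q: "open Q" "snd ?b \<one> \<in> Q" "\<And>u. u \<in> Q \<Longrightarrow> inv_into (fst ?b) (snd ?b) u \<in> fst k"
    using chart_inverse_neighbourhood[OF tb b(2) continuous_map_id Dk(1)] k(2) by (metis id_apply)
  have "isCont y 0" and cu: "isCont (\<lambda>s. \<Psi> (y s)) 0"
    using has_derivative_continuous[OF y] has_derivative_continuous[OF u] by auto
  then have "(y \<longlongrightarrow> S z0) (nhds 0)"
    unfolding isCont_def tendsto_at_iff_tendsto_nhds by (simp only: y0)
  moreover have "((\<lambda>s. \<Psi> (y s)) \<longlongrightarrow> snd ?b \<one>) (nhds 0)"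
    using iffD1[OF tendsto_at_iff_tendsto_nhds cu[unfolded isCont_def]] by (simp only: y0 \<Psi>(1))
  ultimately have "\<forall>\<^sub>F s in nhds 0. y s \<in> W" "\<forall>\<^sub>F s in nhds 0. \<Psi> (y s) \<in> Q"
    using W Q(1,2) topological_tendstoD by blast+
  then have "\<forall>\<^sub>F s in nhds 0. y s \<in> W \<and> \<Psi> (y s) \<in> Q" by (rule eventually_conj)
  then obtain \<delta> where \<delta>: "\<delta> > 0" "\<And>s. \<bar>s\<bar> < \<delta> \<Longrightarrow> y s \<in> W \<and> \<Psi> (y s) \<in> Q"
    by (auto simp: eventually_nhds_metric)
  have "chart_rep ?b k (\<lambda>x. x) (\<Psi> (y s)) \<in> L" if s: "\<bar>s\<bar> < \<delta>" for s
  proof -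
    obtain x where x: "x \<in> fst ?b" "\<Psi> (y s) = snd ?b x" "\<pi> x \<in> fst ?d" "snd ?d (\<pi> x) = z0"
      using \<Psi>(3)[of "y s"] \<delta>(2)[OF s] Ay by metis
    have "\<pi> x = \<pi> \<one>" using inj_onD[OF topological_chartD(2)[OF td] _ x(3) d(2)] x(4) by (simp add: z0_def)
    moreover have "x \<in> carrier G"
      using x(1) openin_subset[OF topological_chartD(1)[OF tb]] points by auto
    ultimately have "x \<in> H" using proj_one_eq_iff by blast
    moreover have "x \<in> fst k" using Q(3)[of "\<Psi> (y s)"] \<delta>(2)[OF s] x(1,2) tb by simp
    ultimately have "snd k x \<in> L" using flat by blast
    then show ?thesis using x(1,2) tb by (simp add: chart_rep_def)
  qed
  then have TZ: "T Z \<in> L" by (rule subspace_contains_derivative[OF L w \<delta>(1)])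
  have k1: "snd k \<one> \<in> snd k ` fst k" "snd k \<one> \<in> L" using k(2) oneH flat by blast+
  have "open (snd k ` fst k)" using Dk(3)[OF openin_topspace] openin_subset[OF Dk(1)]
    by (simp add: Int_absorb2)
  then obtain r where r: "r > 0" "ball (snd k \<one>) r \<subseteq> snd k ` fst k"
    using k1(1) open_contains_ball by blast
  \<comment> \<open>the summand \<open>1\<close> avoids a division by zero when \<open>T Z = 0\<close>\<close>
  define \<epsilon> where "\<epsilon> = r / (2 * (1 + norm (T Z)))"
  have np: "1 + norm (T Z) > 0" using norm_ge_zero[of "T Z"] by linarith
  have \<epsilon>: "\<epsilon> > 0" using r(1) np by (simp add: \<epsilon>_def)
  have line: "snd k \<one> + t *\<^sub>R (\<epsilon> *\<^sub>R T Z) \<in> snd k ` fst k" if t: "t \<in> {0..1}" for t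
  proof -
    have "\<epsilon> * norm (T Z) \<le> \<epsilon> * (1 + norm (T Z))" using \<epsilon> by simp
    also have "\<dots> = r / 2" using np by (simp add: \<epsilon>_def field_simps)
    finally have "\<epsilon> * norm (T Z) < r" using r(1) by simp
    moreover have "t * (\<epsilon> * norm (T Z)) \<le> 1 * (\<epsilon> * norm (T Z))"
      using t \<epsilon> by (intro mult_right_mono) auto
    moreover have "norm (t *\<^sub>R (\<epsilon> *\<^sub>R T Z)) = t * (\<epsilon> * norm (T Z))" using t \<epsilon> by simp
    ultimately have "norm (t *\<^sub>R (\<epsilon> *\<^sub>R T Z)) < r" by linarith
    then have "snd k \<one> + t *\<^sub>R (\<epsilon> *\<^sub>R T Z) \<in> ball (snd k \<one>) r" by (simp add: dist_norm)
    then show ?thesis using r(2) by blast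
  qed
  let ?c = "\<lambda>t. inv_into (fst k) (snd k) (snd k \<one> + t *\<^sub>R (\<epsilon> *\<^sub>R T Z))"
  have c: "smooth_curve MG ?c" by (rule smooth_curve_in_chart[OF locally_euclidean k(1) line])
  have c0: "?c 0 = \<one>" using k(2) tk by simp
  have cH: "?c t \<in> H" if t: "t \<in> {0..1}" for t
  proof -
    have "snd k \<one> + t *\<^sub>R (\<epsilon> *\<^sub>R T Z) \<in> snd k ` (fst k \<inter> H)"
      unfolding flat using line[OF t] k1(2) TZ L by (simp add: subspace_add subspace_scale)
    then obtain x where "x \<in> fst k" "x \<in> H" "snd k \<one> + t *\<^sub>R (\<epsilon> *\<^sub>R T Z) = snd k x" by blast
    then show ?thesis using tk by simp
  qed
  have "velocity MG ?c 0 = \<epsilon> *\<^sub>R Z"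
  proof (rule velocity_eqI)
    have "((\<lambda>t. snd k \<one> + t *\<^sub>R (\<epsilon> *\<^sub>R T Z)) has_derivative (\<lambda>t. t *\<^sub>R (\<epsilon> *\<^sub>R T Z))) (at 0)"
      by (auto intro!: derivative_eq_intros)
    then have "((\<lambda>t. chart_rep k ?b (\<lambda>x. x) (snd k \<one> + t *\<^sub>R (\<epsilon> *\<^sub>R T Z))) has_derivative
        (\<lambda>t. T' (t *\<^sub>R (\<epsilon> *\<^sub>R T Z)))) (at 0)"
      by (rule has_derivative_compose) (simp add: T')
    moreover have "T' (t *\<^sub>R (\<epsilon> *\<^sub>R T Z)) = t *\<^sub>R (\<epsilon> *\<^sub>R Z)" for t
      using linear_cmul[OF has_derivative_linear[OF T']] T'T by simp
    ultimately have "((snd ?b \<circ> ?c) has_vector_derivative \<epsilon> *\<^sub>R Z) (at 0)"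
      by (simp add: has_vector_derivative_def chart_rep_def o_def)
    then show "((snd (chart_at MG (?c 0)) \<circ> ?c) has_vector_derivative \<epsilon> *\<^sub>R Z) (at 0 within {0..1})"
      unfolding c0 by (rule has_vector_derivative_at_within)
  qed simp
  then have vel: "\<epsilon> *\<^sub>R Z = velocity MG ?c 0" by (rule sym)
  have cH': "?c ` {0..1} \<subseteq> H" using cH by (rule image_subsetI)
  have "\<epsilon> *\<^sub>R Z \<in> lie_algebra_of G MG H"
    unfolding lie_algebra_of_def mem_Collect_eq
    by (rule exI, rule conjI[OF vel], rule conjI[OF c], rule conjI[OF cH' c0])
  with \<epsilon> show ?thesis by (intro exI[of _ \<epsilon>] conjI)
qed

text \<open>The Lie algebra of \<open>H\<close> is mapped to \<open>0\<close>, so its complement already has the full image. A kernel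
  vector in \<open>\<mm>\<close> has a positive multiple in the Lie algebra of \<open>H\<close>, which meets \<open>\<mm>\<close> only in \<open>0\<close>.\<close>

lemma tangent_proj_bij_betw_complement:
  assumes "reductive_complement G MG H \<mm>"
  shows "bij_betw (tangent_map MG M \<pi> \<one>) \<mm> UNIV"
proof -
  let ?A = "tangent_map MG M \<pi> \<one>"
  have m: "subspace \<mm>" "lie_algebra_of G MG H \<inter> \<mm> = {0}"
    "\<And>X. \<exists>Y\<in>lie_algebra_of G MG H. \<exists>Z\<in>\<mm>. X = Y + Z"
    using assms by (auto simp: reductive_complement_def)
  have lin: "linear ?A"
    by (rule tangent_map_linear[OF locally_euclidean locally_euclidean_quotient differentiable_proj]) (simp add: points)
  have "Z = 0" if Z: "Z \<in> \<mm>" "?A Z = 0" for Z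
  proof -
    obtain \<epsilon> where \<epsilon>: "\<epsilon> > 0" "\<epsilon> *\<^sub>R Z \<in> lie_algebra_of G MG H"
      using kernel_proj_lie_algebra[OF Z(2)] by blast
    then have "\<epsilon> *\<^sub>R Z \<in> {0}" using m(1,2) Z(1) subspace_scale by blast
    then show ?thesis using \<epsilon>(1) by simp
  qed
  then have "inj_on ?A \<mm>" using linear_injective_on_subspace_0[OF lin m(1)] by blast
  moreover have "v \<in> ?A ` \<mm>" for v
  proof -
    obtain X where X: "v = ?A X" using surj_tangent_proj[OF one_closed] by (metis surjD)
    obtain Y Z where YZ: "Y \<in> lie_algebra_of G MG H" "Z \<in> \<mm>" "X = Y + Z" using m(3) by blast
    have "v = ?A Z" using X YZ tangent_proj_lie_algebra[OF YZ(1)] by (simp add: linear_add[OF lin])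
    then show ?thesis using YZ(2) by blast
  qed
  ultimately show ?thesis by (auto simp: bij_betw_def)
qed

end

section \<open>Homogeneity of the square root velocity transform\<close>

context homogeneous_manifold
begin

lemma omega_e_scaleR:
  assumes red: "reductive_complement G MG H \<mm>"
  shows "omega_e G MG H M \<mm> (r *\<^sub>R v) = r *\<^sub>R omega_e G MG H M \<mm> v"
proof -
  let ?A = "tangent_map MG M \<pi> \<one>"
  have bij: "inj_on ?A \<mm>" "?A ` \<mm> = UNIV"
    using tangent_proj_bij_betw_complement[OF red] by (auto simp: bij_betw_def)
  have lin: "linear ?A"
    by (rule tangent_map_linear[OF locally_euclidean locally_euclidean_quotient differentiable_proj]) (simp add: points)
  have v: "omega_e G MG H M \<mm> v \<in> \<mm>" "?A (omega_e G MG H M \<mm> v) = v"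
    unfolding omega_e_def using bij(2) by (auto intro: inv_into_into f_inv_into_f)
  have "subspace \<mm>" using red by (simp add: reductive_complement_def)
  then have "inv_into \<mm> ?A (r *\<^sub>R v) = r *\<^sub>R omega_e G MG H M \<mm> v"
    using v by (intro inv_into_f_eq bij(1)) (simp_all add: subspace_scale linear_cmul[OF lin])
  then show ?thesis by (simp only: omega_e_def)
qed

text \<open>The chosen representative depends on the base point alone, so it is the same for both vectors.\<close>

lemma omega_scaleR:
  assumes red: "reductive_complement G MG H \<mm>" and p: "p \<in> points M"
  shows "omega G MG H M \<mm> p (r *\<^sub>R v) = r *\<^sub>R omega G MG H M \<mm> p v"
proof -
  define g where "g = (SOME g. g \<in> carrier G \<and> \<pi> g = p)"
  have "\<exists>g. g \<in> carrier G \<and> \<pi> g = p" using p unfolding points_quotient by blast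
  from someI_ex[OF this] have g: "g \<in> carrier G" unfolding g_def by (rule conjunct1)
  have om: "omega G MG H M \<mm> p v =
      Ad G MG g (omega_e G MG H M \<mm> (tangent_map M M (coset_action G (inv g)) p v))" for v
    by (simp add: omega_def g_def Let_def)
  show ?thesis
    unfolding om linear_cmul[OF action_tangent_linear[OF inv_closed[OF g] p]] omega_e_scaleR[OF red]
      linear_cmul[OF linear_Ad[OF g]] ..
qed

lemma theta_omega_reparametrise:
  assumes red: "reductive_complement G MG H \<mm>" and f: "smooth_curve M f"
    and \<phi>: "\<phi> \<in> Diff_plus" and t: "t \<in> {0..1}"
  shows "theta_omega G MG H M \<mm> (f \<circ> \<phi>) t =
    vector_derivative \<phi> (at t within {0..1}) *\<^sub>R theta_omega G MG H M \<mm> f (\<phi> t)"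
  unfolding theta_omega_def velocity_reparametrise[OF locally_euclidean_quotient f \<phi> t] comp_apply
  by (rule omega_scaleR[OF red smooth_curve_points[OF f Diff_plus_maps_to[OF \<phi> t]]])

text \<open>The velocity of the reparametrised curve gains the factor \<open>\<phi>'\<close> and its evolution is merely
  reparametrised; \<^const>\<open>Psi\<close> is linear in the velocity once the evolution is known.\<close>

lemma Psi_reparametrise:
  assumes red: "reductive_complement G MG H \<mm>" and f: "smooth_curve M f"
    and \<phi>: "\<phi> \<in> Diff_plus" and t: "t \<in> {0..1}" and k: "k \<in> carrier G"
  shows "Psi G MG k (theta_omega G MG H M \<mm> (f \<circ> \<phi>)) t =
    vector_derivative \<phi> (at t within {0..1}) *\<^sub>R Psi G MG k (theta_omega G MG H M \<mm> f) (\<phi> t)"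
proof -
  note \<theta> = theta_omega_reparametrise[OF red f \<phi>]
  have "k \<otimes> inv (Evol G MG (theta_omega G MG H M \<mm> f) (\<phi> t)) \<in> carrier G"
    using k Evol_carrier[OF Diff_plus_maps_to[OF \<phi> t]] by simp
  moreover have "Evol G MG (theta_omega G MG H M \<mm> (f \<circ> \<phi>)) t = Evol G MG (theta_omega G MG H M \<mm> f) (\<phi> t)"
    by (rule Evol_reparametrise[OF \<phi> \<theta> t])
  ultimately show ?thesis
    unfolding Psi_def \<theta>[OF t]
    by (simp only: linear_cmul[OF linear_Ad] scaleR_minus_right)
qed

end

lemma norm_of_scaleR:
  assumes "inner_product B" "r \<ge> 0"
  shows "norm_of B (r *\<^sub>R w) = r * norm_of B w"
proof -
  have lin: "linear (B x)" and sym: "B x y = B y x" for x y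
    using assms(1) by (simp_all add: inner_product_def)
  have "B (r *\<^sub>R w) (r *\<^sub>R w) = r * B (r *\<^sub>R w) w" using linear_cmul[OF lin] by simp
  also have "B (r *\<^sub>R w) w = r * B w w" using sym[of "r *\<^sub>R w" w] linear_cmul[OF lin] by simp
  finally show ?thesis using assms(2) by (simp add: norm_of_def real_sqrt_mult)
qed

text \<open>For \<open>w = 0\<close> the quotient is \<open>1 / 0 = 0\<close>, and both sides vanish.\<close>

lemma square_root_scaling:
  assumes "inner_product B" "r > 0"
  shows "(1 / sqrt (norm_of B (r *\<^sub>R w))) *\<^sub>R (r *\<^sub>R w) = sqrt r *\<^sub>R ((1 / sqrt (norm_of B w)) *\<^sub>R w)"
proof -
  have "r / (sqrt r * s) = sqrt r / s" for s
    using assms(2) by (simp add: real_div_sqrt flip: divide_divide_eq_left)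
  then show ?thesis
    using assms(2) by (simp add: norm_of_scaleR[OF assms(1)] real_sqrt_mult)
qed

text \<open>For nonnegative functions integrability is absolute integrability, which is preserved by the change of
  variables in both directions; if it fails, both integrals are \<open>0\<close> by convention.\<close>

lemma integral_Diff_plus_substitution:
  fixes F :: "real \<Rightarrow> real"
  assumes \<phi>: "\<phi> \<in> Diff_plus" and F: "\<And>t. F t \<ge> 0"
  shows "integral {0..1} (\<lambda>t. vector_derivative \<phi> (at t within {0..1}) * F (\<phi> t)) = integral {0..1} F"
proof -
  define \<phi>' where "\<phi>' t = vector_derivative \<phi> (at t within {0..1})" for t
  have pos: "\<phi>' t > 0" if "t \<in> {0..1}" for t
    unfolding \<phi>'_def by (rule Diff_plus_derivative(2)[OF \<phi> that])
  have bij: "inj_on \<phi> {0..1}" "\<phi> ` {0..1} = {0..1}" using \<phi> by (auto simp: Diff_plus_def bij_betw_def)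
  have der: "(\<phi> has_field_derivative \<phi>' t) (at t within {0..1})" if "t \<in> {0..1}" for t
    using Diff_plus_derivative(1)[OF \<phi> that]
    by (simp add: \<phi>'_def has_real_derivative_iff_has_vector_derivative)
  have cov: "(\<lambda>t. \<bar>\<phi>' t\<bar> * F (\<phi> t)) absolutely_integrable_on {0..1} \<and>
      integral {0..1} (\<lambda>t. \<bar>\<phi>' t\<bar> * F (\<phi> t)) = b \<longleftrightarrow>
      F absolutely_integrable_on {0..1} \<and> integral {0..1} F = b" for b
    using has_absolute_integral_change_of_variables_1'[OF _ der bij(1), of F b] by (simp add: bij(2))
  have eq: "integral {0..1} (\<lambda>t. \<phi>' t * F (\<phi> t)) = integral {0..1} (\<lambda>t. \<bar>\<phi>' t\<bar> * F (\<phi> t))"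
    by (rule integral_cong) (use pos in force)
  have "integral {0..1} (\<lambda>t. \<bar>\<phi>' t\<bar> * F (\<phi> t)) = integral {0..1} F"
  proof (cases "F integrable_on {0..1}")
    case True
    then have "F absolutely_integrable_on {0..1}"
      using F by (intro nonnegative_absolutely_integrable_1) auto
    then show ?thesis using cov by blast
  next
    case False
    then have "\<not> F absolutely_integrable_on {0..1}"
      using set_lebesgue_integral_eq_integral(1) by blast
    then have "\<not> (\<lambda>t. \<bar>\<phi>' t\<bar> * F (\<phi> t)) absolutely_integrable_on {0..1}" using cov by blast
    then have "\<not> (\<lambda>t. \<bar>\<phi>' t\<bar> * F (\<phi> t)) integrable_on {0..1}"
      using F nonnegative_absolutely_integrable_1[of "\<lambda>t. \<bar>\<phi>' t\<bar> * F (\<phi> t)"] by auto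
    then show ?thesis using False by (simp add: not_integrable_integral)
  qed
  then show ?thesis using eq by (simp add: \<phi>'_def)
qed

theorem lemma22:
  fixes G :: "'g monoid"
    and MG :: "('g, 'e::euclidean_space) manifold"
    and H :: "'g set"
    and M :: "('g set, 'f::euclidean_space) manifold"
    and \<mm> :: "'e set"
    and B :: "'e \<Rightarrow> 'e \<Rightarrow> real"
    and c0 :: "'g set"
    and g0 :: 'g
  assumes "homogeneous_space G MG H M"
    and "reductive_complement G MG H \<mm>"
    and "inner_product B"
    and "c0 \<in> points M"
    and "g0 \<in> carrier G" and "coset_proj G H g0 = c0"
  shows "reparametrisation_invariant (regular_curves M c0) (reductive_srvt_dist G MG H M \<mm> B g0)"
proof -
  have lie: "lie_group G MG" using assms(1) by (simp add: homogeneous_space_def)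
  then interpret homogeneous_manifold G MG H M
    using assms(1)
    by (intro homogeneous_manifold.intro lie_group_manifold.intro lie_group_manifold_axioms.intro
        homogeneous_manifold_axioms.intro) (simp_all add: lie_group_def)
  let ?R = "reductive_srvt G MG H M \<mm> B g0"
  have srvt: "?R (f \<circ> \<phi>) t = sqrt (vector_derivative \<phi> (at t within {0..1})) *\<^sub>R ?R f (\<phi> t)"
    if "f \<in> regular_curves M c0" "\<phi> \<in> Diff_plus" "t \<in> {0..1}" for f \<phi> t
  proof -
    have f: "smooth_curve M f" using that(1) by (simp add: regular_curves_def)
    show ?thesis
      unfolding reductive_srvt_def Let_def
        Psi_reparametrise[OF assms(2) f that(2,3) inv_closed[OF assms(5)]]
      by (rule square_root_scaling[OF assms(3) Diff_plus_derivative(2)[OF that(2,3)]])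
  qed
  show ?thesis
    unfolding reparametrisation_invariant_def
  proof (intro ballI)
    fix f g \<phi> assume f: "f \<in> regular_curves M c0" and g: "g \<in> regular_curves M c0" and \<phi>: "\<phi> \<in> Diff_plus"
    let ?F = "\<lambda>t. (norm_of B (?R f t - ?R g t))\<^sup>2"
    have "(norm_of B (?R (f \<circ> \<phi>) t - ?R (g \<circ> \<phi>) t))\<^sup>2 = vector_derivative \<phi> (at t within {0..1}) * ?F (\<phi> t)"
      if t: "t \<in> {0..1}" for t
    proof -
      have pos: "vector_derivative \<phi> (at t within {0..1}) > 0" by (rule Diff_plus_derivative(2)[OF \<phi> t])
      have "?R (f \<circ> \<phi>) t - ?R (g \<circ> \<phi>) t =
          sqrt (vector_derivative \<phi> (at t within {0..1})) *\<^sub>R (?R f (\<phi> t) - ?R g (\<phi> t))"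
        by (simp add: srvt[OF f \<phi> t] srvt[OF g \<phi> t] scaleR_diff_right)
      then show ?thesis using pos by (simp add: norm_of_scaleR[OF assms(3)] power_mult_distrib)
    qed
    then have "integral {0..1} (\<lambda>t. (norm_of B (?R (f \<circ> \<phi>) t - ?R (g \<circ> \<phi>) t))\<^sup>2) =
        integral {0..1} (\<lambda>t. vector_derivative \<phi> (at t within {0..1}) * ?F (\<phi> t))"
      by (rule integral_cong)
    also have "\<dots> = integral {0..1} ?F" by (rule integral_Diff_plus_substitution[OF \<phi>]) simp
    finally show "reductive_srvt_dist G MG H M \<mm> B g0 f g =
        reductive_srvt_dist G MG H M \<mm> B g0 (f \<circ> \<phi>) (g \<circ> \<phi>)"
      by (simp add: reductive_srvt_dist_def dist_L2_def)
  qed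
qed

end
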